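(* The collection of all FRBSU monoidal categories forms a 2-category $\mathcal{MCT}$ in which the objects are the FRBSU monoidal categories, the 1-arrows $\mathcal{A}\to\mathcal{B}$ are the braided monoidal functors from $\mathcal{A}$ to $\mathcal{B}$, and the 2-arrows $\mathcal{K}\Rightarrow\mathcal{L}$ are the natural isomorphisms of monoidal functors from $\mathcal{K}$ to $\mathcal{L}$.
   Context: An FRBSU monoidal category is a finite, rigid, braided monoidal category whose unit object $I$ is simple. Finite: a $k$-linear abelian category $\mathcal{A}$, with $k$ a perfect field, is finite if $\mathrm{Hom}_{\mathcal{A}}(X,Y)$ is a finite dimensional $k$-vector space for all objects $X,Y$, every object has finite length, every simple object has a projective cover (here: a projective object $P$ with an epimorphism onto the given object), and there are finitely many isomorphism classes of simple objects. Rigid: every object $X$ has a right dual $X^+$ (with morphisms $X^+\otimes X\to I$ and $I\to X\otimes X^+$ satisfying the two usual zig-zag identities) and a left dual ${}^+X$ (with morphisms $X\otimes {}^+X\to I$ and $I\to {}^+X\otimes X$ satisfying the two usual zig-zag identities). Braided: equipped with a natural family of isomorphisms $c_{XY}:X\otimes Y\to Y\otimes X$ satisfying the two hexagon axioms. A monoidal functor $(\mathcal{F},\gamma,\varphi):\mathcal{A}\to\mathcal{B}$ is a functor $\mathcal{F}$ with natural isomorphisms $\gamma_{XY}:\mathcal{F}(X)\otimes\mathcal{F}(Y)\to\mathcal{F}(X\otimes Y)$ and an isomorphism $\varphi:I\to\mathcal{F}(I)$ satisfying the usual associativity and unit coherence conditions. It is braided if $\mathcal{F}(c_{XY})\circ\gamma_{XY}=\gamma_{YX}\circ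 c_{\mathcal{F}(X)\mathcal{F}(Y)}$ for all $X,Y$. A natural transformation $\theta:\mathcal{F}\to\mathcal{G}$ of monoidal functors is a natural transformation of the underlying functors such that $\theta(X\otimes Y)\circ\gamma^{\mathcal{F}}_{XY}=\gamma^{\mathcal{G}}_{XY}\circ(\theta(X)\otimes\theta(Y))$ and $\theta(I)\circ\varphi^{\mathcal{F}}=\varphi^{\mathcal{G}}$. A 2-category is a bicategory in which the associativity and unit constraints are identities, so that composition of 1-arrows (and likewise horizontal composition of 2-arrows) is strictly associative and strictly unital. Composition of 1-arrows in $\mathcal{MCT}$ is composition of monoidal functors (for $(\mathcal{F},\beta,\varphi_1):\mathcal{B}\to\mathcal{C}$ and $(\mathcal{G},\psi,\varphi_2):\mathcal{A}\to\mathcal{B}$, the monoidal structure on $\mathcal{F}\circ\mathcal{G}$ is $\mathcal{F}(\psi_{AB})\circ\beta_{\mathcal{G}(A)\mathcal{G}(B)}$ and $\mathcal{F}(\varphi_2)\circ\varphi_1$), and 2-arrows are composed by the usual vertical and horizontal composition of natural transformations. *)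

theory Defs
  imports "HOL-Algebra.Module" "HOL-Computational_Algebra.Primes"
begin

section \<open>Categories, functors and natural transformations\<close>

text \<open>Operations are total HOL functions; only their values on the carriers \<open>Obj\<close> and \<open>Arr\<close>
  (and, for composition, on composable pairs) are constrained.\<close>

record ('o, 'a) cat =
  Obj :: "'o set"
  Arr :: "'a set"
  src :: "'a \<Rightarrow> 'o"
  tgt :: "'a \<Rightarrow> 'o"
  ident :: "'o \<Rightarrow> 'a"
  cmp :: "'a \<Rightarrow> 'a \<Rightarrow> 'a"  (infixr "\<bullet>\<index>" 65)

definition homset :: "('o, 'a, 'm) cat_scheme \<Rightarrow> 'o \<Rightarrow> 'o \<Rightarrow> 'a set" where
  "homset C X Y = {f \<in> Arr C. src C f = X \<and> tgt C f = Y}"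

locale category =
  fixes C :: "('o, 'a, 'm) cat_scheme" (structure)
  assumes src_in: "f \<in> Arr C \<Longrightarrow> src C f \<in> Obj C"
    and tgt_in: "f \<in> Arr C \<Longrightarrow> tgt C f \<in> Obj C"
    and ident_in: "X \<in> Obj C \<Longrightarrow> ident C X \<in> homset C X X"
    and cmp_in: "\<lbrakk>f \<in> homset C X Y; g \<in> homset C Y Z\<rbrakk> \<Longrightarrow> g \<bullet> f \<in> homset C X Z"
    and cmp_ident_left: "f \<in> homset C X Y \<Longrightarrow> ident C Y \<bullet> f = f"
    and cmp_ident_right: "f \<in> homset C X Y \<Longrightarrow> f \<bullet> ident C X = f"
    and cmp_assoc: "\<lbrakk>f \<in> homset C W X; g \<in> homset C X Y; h \<in> homset C Y Z\<rbrakk>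
      \<Longrightarrow> (h \<bullet> g) \<bullet> f = h \<bullet> (g \<bullet> f)"

definition inverse_arrows :: "('o, 'a, 'm) cat_scheme \<Rightarrow> 'a \<Rightarrow> 'a \<Rightarrow> bool" where
  "inverse_arrows C f g \<longleftrightarrow> f \<in> Arr C \<and> g \<in> homset C (tgt C f) (src C f) \<and>
     g \<bullet>\<^bsub>C\<^esub> f = ident C (src C f) \<and> f \<bullet>\<^bsub>C\<^esub> g = ident C (tgt C f)"

definition isos :: "('o, 'a, 'm) cat_scheme \<Rightarrow> 'o \<Rightarrow> 'o \<Rightarrow> 'a set" where
  "isos C X Y = {f \<in> homset C X Y. \<exists>g. inverse_arrows C f g}"

definition inverse_of :: "('o, 'a, 'm) cat_scheme \<Rightarrow> 'a \<Rightarrow> 'a" where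
  "inverse_of C f = (THE g. inverse_arrows C f g)"

definition monic :: "('o, 'a, 'm) cat_scheme \<Rightarrow> 'a \<Rightarrow> bool" where
  "monic C f \<longleftrightarrow> f \<in> Arr C \<and>
     (\<forall>W. \<forall>g\<in>homset C W (src C f). \<forall>h\<in>homset C W (src C f).
        f \<bullet>\<^bsub>C\<^esub> g = f \<bullet>\<^bsub>C\<^esub> h \<longrightarrow> g = h)"

definition epic :: "('o, 'a, 'm) cat_scheme \<Rightarrow> 'a \<Rightarrow> bool" where
  "epic C f \<longleftrightarrow> f \<in> Arr C \<and>
     (\<forall>Z. \<forall>g\<in>homset C (tgt C f) Z. \<forall>h\<in>homset C (tgt C f) Z.
        g \<bullet>\<^bsub>C\<^esub> f = h \<bullet>\<^bsub>C\<^esub> f \<longrightarrow> g = h)"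

definition prod_cat :: "('o, 'a, 'm) cat_scheme \<Rightarrow> ('p, 'b, 'n) cat_scheme
    \<Rightarrow> ('o \<times> 'p, 'a \<times> 'b) cat" where
  "prod_cat C D = \<lparr>
     Obj = Obj C \<times> Obj D,
     Arr = Arr C \<times> Arr D,
     src = (\<lambda>(f, g). (src C f, src D g)),
     tgt = (\<lambda>(f, g). (tgt C f, tgt D g)),
     ident = (\<lambda>(X, Y). (ident C X, ident D Y)),
     cmp = (\<lambda>(f, g) (f', g'). (f \<bullet>\<^bsub>C\<^esub> f', g \<bullet>\<^bsub>D\<^esub> g'))\<rparr>"

record ('o, 'a, 'p, 'b) func =
  omap :: "'o \<Rightarrow> 'p"
  amap :: "'a \<Rightarrow> 'b"

locale cat_functor = A: category A + B: category B
  for A :: "('o, 'a, 'm) cat_scheme" and B :: "('p, 'b, 'n) cat_scheme"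
  and F :: "('o, 'a, 'p, 'b, 'r) func_scheme" +
  assumes omap_in: "X \<in> Obj A \<Longrightarrow> omap F X \<in> Obj B"
    and amap_in: "f \<in> homset A X Y \<Longrightarrow> amap F f \<in> homset B (omap F X) (omap F Y)"
    and amap_ident: "X \<in> Obj A \<Longrightarrow> amap F (ident A X) = ident B (omap F X)"
    and amap_cmp: "\<lbrakk>f \<in> homset A X Y; g \<in> homset A Y Z\<rbrakk>
      \<Longrightarrow> amap F (g \<bullet>\<^bsub>A\<^esub> f) = amap F g \<bullet>\<^bsub>B\<^esub> amap F f"

locale nat_trans = F: cat_functor A B F + G: cat_functor A B G
  for A :: "('o, 'a, 'm) cat_scheme" and B :: "('p, 'b, 'n) cat_scheme"
  and F :: "('o, 'a, 'p, 'b, 'r) func_scheme" and G :: "('o, 'a, 'p, 'b, 's) func_scheme"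
  and \<theta> :: "'o \<Rightarrow> 'b" +
  assumes component_in: "X \<in> Obj A \<Longrightarrow> \<theta> X \<in> homset B (omap F X) (omap G X)"
    and naturality: "f \<in> homset A X Y \<Longrightarrow> \<theta> Y \<bullet>\<^bsub>B\<^esub> amap F f = amap G f \<bullet>\<^bsub>B\<^esub> \<theta> X"

section \<open>Finite linear abelian categories\<close>

text \<open>Characteristic \<open>0\<close>, or characteristic \<open>p\<close> with surjective Frobenius map.\<close>

definition perfect_field :: "('k, 'n) ring_scheme \<Rightarrow> bool" where
  "perfect_field K \<longleftrightarrow> field K \<and>
     (\<forall>p::nat. prime p \<longrightarrow> [p] \<cdot>\<^bsub>K\<^esub> \<one>\<^bsub>K\<^esub> = \<zero>\<^bsub>K\<^esub> \<longrightarrow>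
        (\<forall>x\<in>carrier K. \<exists>y\<in>carrier K. y [^]\<^bsub>K\<^esub> p = x))"

record ('o, 'a, 'k) lincat = "('o, 'a) cat" +
  hom_mod :: "'o \<Rightarrow> 'o \<Rightarrow> ('k, 'a) module"

locale linear_category = category C
  for K :: "('k, 'n) ring_scheme" and C :: "('o, 'a, 'k, 'm) lincat_scheme" (structure) +
  assumes carrier_hom_mod: "\<lbrakk>X \<in> Obj C; Y \<in> Obj C\<rbrakk> \<Longrightarrow> carrier (hom_mod C X Y) = homset C X Y"
    and module_hom_mod: "\<lbrakk>X \<in> Obj C; Y \<in> Obj C\<rbrakk> \<Longrightarrow> module K (hom_mod C X Y)"
    and cmp_add_right: "\<lbrakk>f \<in> homset C X Y; f' \<in> homset C X Y; g \<in> homset C Y Z\<rbrakk>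
      \<Longrightarrow> g \<bullet> (f \<oplus>\<^bsub>hom_mod C X Y\<^esub> f') = (g \<bullet> f) \<oplus>\<^bsub>hom_mod C X Z\<^esub> (g \<bullet> f')"
    and cmp_add_left: "\<lbrakk>f \<in> homset C X Y; g \<in> homset C Y Z; g' \<in> homset C Y Z\<rbrakk>
      \<Longrightarrow> (g \<oplus>\<^bsub>hom_mod C Y Z\<^esub> g') \<bullet> f = (g \<bullet> f) \<oplus>\<^bsub>hom_mod C X Z\<^esub> (g' \<bullet> f)"
    and cmp_smult_right: "\<lbrakk>a \<in> carrier K; f \<in> homset C X Y; g \<in> homset C Y Z\<rbrakk>
      \<Longrightarrow> g \<bullet> (a \<odot>\<^bsub>hom_mod C X Y\<^esub> f) = a \<odot>\<^bsub>hom_mod C X Z\<^esub> (g \<bullet> f)"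
    and cmp_smult_left: "\<lbrakk>a \<in> carrier K; f \<in> homset C X Y; g \<in> homset C Y Z\<rbrakk>
      \<Longrightarrow> (a \<odot>\<^bsub>hom_mod C Y Z\<^esub> g) \<bullet> f = a \<odot>\<^bsub>hom_mod C X Z\<^esub> (g \<bullet> f)"

definition zero_arr :: "('o, 'a, 'k, 'm) lincat_scheme \<Rightarrow> 'o \<Rightarrow> 'o \<Rightarrow> 'a" where
  "zero_arr C X Y = \<zero>\<^bsub>hom_mod C X Y\<^esub>"

definition zero_object :: "('o, 'a, 'm) cat_scheme \<Rightarrow> 'o \<Rightarrow> bool" where
  "zero_object C Z \<longleftrightarrow> Z \<in> Obj C \<and>
     (\<forall>X\<in>Obj C. (\<exists>!f. f \<in> homset C X Z) \<and> (\<exists>!f. f \<in> homset C Z X))"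

definition is_kernel :: "('o, 'a, 'k, 'm) lincat_scheme \<Rightarrow> 'a \<Rightarrow> 'a \<Rightarrow> bool" where
  "is_kernel C f k \<longleftrightarrow> f \<in> Arr C \<and> k \<in> Arr C \<and> tgt C k = src C f \<and>
     f \<bullet>\<^bsub>C\<^esub> k = zero_arr C (src C k) (tgt C f) \<and>
     (\<forall>W. \<forall>h\<in>homset C W (src C f). f \<bullet>\<^bsub>C\<^esub> h = zero_arr C W (tgt C f) \<longrightarrow>
        (\<exists>!u. u \<in> homset C W (src C k) \<and> k \<bullet>\<^bsub>C\<^esub> u = h))"

definition is_cokernel :: "('o, 'a, 'k, 'm) lincat_scheme \<Rightarrow> 'a \<Rightarrow> 'a \<Rightarrow> bool" where
  "is_cokernel C f q \<longleftrightarrow> f \<in> Arr C \<and> q \<in> Arr C \<and> src C q = tgt C f \<and>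
     q \<bullet>\<^bsub>C\<^esub> f = zero_arr C (src C f) (tgt C q) \<and>
     (\<forall>W. \<forall>h\<in>homset C (tgt C f) W. h \<bullet>\<^bsub>C\<^esub> f = zero_arr C (src C f) W \<longrightarrow>
        (\<exists>!u. u \<in> homset C (tgt C q) W \<and> u \<bullet>\<^bsub>C\<^esub> q = h))"

locale abelian_category = linear_category K C
  for K :: "('k, 'n) ring_scheme" and C :: "('o, 'a, 'k, 'm) lincat_scheme" (structure) +
  assumes ex_zero_object: "\<exists>Z. zero_object C Z"
    and ex_biproduct: "\<lbrakk>X \<in> Obj C; Y \<in> Obj C\<rbrakk> \<Longrightarrow>
      \<exists>P\<in>Obj C. \<exists>p1\<in>homset C P X. \<exists>p2\<in>homset C P Y. \<exists>i1\<in>homset C X P. \<exists>i2\<in>homset C Y P.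
        p1 \<bullet> i1 = ident C X \<and> p2 \<bullet> i2 = ident C Y \<and>
        (i1 \<bullet> p1) \<oplus>\<^bsub>hom_mod C P P\<^esub> (i2 \<bullet> p2) = ident C P"
    and ex_kernel: "f \<in> Arr C \<Longrightarrow> \<exists>k. is_kernel C f k"
    and ex_cokernel: "f \<in> Arr C \<Longrightarrow> \<exists>q. is_cokernel C f q"
    and monic_is_kernel: "monic C k \<Longrightarrow> \<exists>f. is_kernel C f k"
    and epic_is_cokernel: "epic C q \<Longrightarrow> \<exists>f. is_cokernel C f q"

definition simple_object :: "('o, 'a, 'm) cat_scheme \<Rightarrow> 'o \<Rightarrow> bool" where
  "simple_object C S \<longleftrightarrow> S \<in> Obj C \<and> \<not> zero_object C S \<and>
     (\<forall>X. \<forall>m\<in>homset C X S. monic C m \<longrightarrow> zero_object C X \<or> m \<in> isos C X S)"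

text \<open>A composition series \<open>0 = Y 0 \<rightarrow> Y 1 \<rightarrow> \<dots> \<rightarrow> Y n = X\<close> of monomorphisms with simple cokernels.\<close>

definition finite_length :: "('o, 'a, 'k, 'm) lincat_scheme \<Rightarrow> 'o \<Rightarrow> bool" where
  "finite_length C X \<longleftrightarrow> (\<exists>(n::nat) Y m.
     zero_object C (Y 0) \<and> Y n = X \<and>
     (\<forall>i<n. m i \<in> homset C (Y i) (Y (Suc i)) \<and> monic C (m i) \<and>
        (\<exists>q. is_cokernel C (m i) q \<and> simple_object C (tgt C q))))"

definition projective_object :: "('o, 'a, 'm) cat_scheme \<Rightarrow> 'o \<Rightarrow> bool" where
  "projective_object C P \<longleftrightarrow> P \<in> Obj C \<and>
     (\<forall>X Y. \<forall>e\<in>homset C X Y. \<forall>f\<in>homset C P Y. epic C e \<longrightarrow>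
        (\<exists>g\<in>homset C P X. e \<bullet>\<^bsub>C\<^esub> g = f))"

definition finite_dimensional :: "('k, 'n) ring_scheme \<Rightarrow> ('k, 'a) module \<Rightarrow> bool" where
  "finite_dimensional K M \<longleftrightarrow> (\<exists>S. finite S \<and> S \<subseteq> carrier M \<and>
     (\<forall>x\<in>carrier M. \<exists>c\<in>S \<rightarrow> carrier K. x = (\<Oplus>\<^bsub>M\<^esub>s\<in>S. c s \<odot>\<^bsub>M\<^esub> s)))"

text \<open>Here a projective cover of \<open>S\<close> is any projective object with an epimorphism onto \<open>S\<close>.\<close>

locale finite_category = abelian_category K C
  for K :: "('k, 'n) ring_scheme" and C :: "('o, 'a, 'k, 'm) lincat_scheme" (structure) +
  assumes perfect: "perfect_field K"
    and hom_finite: "\<lbrakk>X \<in> Obj C; Y \<in> Obj C\<rbrakk> \<Longrightarrow> finite_dimensional K (hom_mod C X Y)"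
    and ex_composition_series: "X \<in> Obj C \<Longrightarrow> finite_length C X"
    and ex_projective_cover: "simple_object C S \<Longrightarrow>
      \<exists>P. projective_object C P \<and> (\<exists>e\<in>homset C P S. epic C e)"
    and finitely_many_simples: "\<exists>R. finite R \<and> (\<forall>S\<in>R. simple_object C S) \<and>
      (\<forall>S. simple_object C S \<longrightarrow> (\<exists>T\<in>R. isos C S T \<noteq> {}))"

section \<open>Braided rigid monoidal categories\<close>

record ('o, 'a, 'k) moncat = "('o, 'a, 'k) lincat" +
  munit :: "'o"
  tensO :: "'o \<Rightarrow> 'o \<Rightarrow> 'o"  (infixr "\<otimes>\<^sub>o\<index>" 70)
  tensA :: "'a \<Rightarrow> 'a \<Rightarrow> 'a"  (infixr "\<otimes>\<^sub>a\<index>" 70)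
  asc :: "'o \<Rightarrow> 'o \<Rightarrow> 'o \<Rightarrow> 'a"
  lun :: "'o \<Rightarrow> 'a"
  run :: "'o \<Rightarrow> 'a"

definition tensor_func :: "('o, 'a, 'k, 'm) moncat_scheme \<Rightarrow> ('o \<times> 'o, 'a \<times> 'a, 'o, 'a) func" where
  "tensor_func C = \<lparr>omap = (\<lambda>(X, Y). tensO C X Y), amap = (\<lambda>(f, g). tensA C f g)\<rparr>"

locale monoidal_category = category C
  for C :: "('o, 'a, 'k, 'm) moncat_scheme" (structure) +
  assumes tensor_functor: "cat_functor (prod_cat C C) C (tensor_func C)"
    and unit_in: "munit C \<in> Obj C"
    and asc_iso: "\<lbrakk>X \<in> Obj C; Y \<in> Obj C; Z \<in> Obj C\<rbrakk>
      \<Longrightarrow> asc C X Y Z \<in> isos C ((X \<otimes>\<^sub>o Y) \<otimes>\<^sub>o Z) (X \<otimes>\<^sub>o (Y \<otimes>\<^sub>o Z))"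
    and lun_iso: "X \<in> Obj C \<Longrightarrow> lun C X \<in> isos C (munit C \<otimes>\<^sub>o X) X"
    and run_iso: "X \<in> Obj C \<Longrightarrow> run C X \<in> isos C (X \<otimes>\<^sub>o munit C) X"
    and asc_natural: "\<lbrakk>f \<in> homset C X X'; g \<in> homset C Y Y'; h \<in> homset C Z Z'\<rbrakk>
      \<Longrightarrow> asc C X' Y' Z' \<bullet> ((f \<otimes>\<^sub>a g) \<otimes>\<^sub>a h) = (f \<otimes>\<^sub>a (g \<otimes>\<^sub>a h)) \<bullet> asc C X Y Z"
    and lun_natural: "f \<in> homset C X Y
      \<Longrightarrow> lun C Y \<bullet> (ident C (munit C) \<otimes>\<^sub>a f) = f \<bullet> lun C X"
    and run_natural: "f \<in> homset C X Y
      \<Longrightarrow> run C Y \<bullet> (f \<otimes>\<^sub>a ident C (munit C)) = f \<bullet> run C X"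
    and pentagon: "\<lbrakk>W \<in> Obj C; X \<in> Obj C; Y \<in> Obj C; Z \<in> Obj C\<rbrakk>
      \<Longrightarrow> asc C W X (Y \<otimes>\<^sub>o Z) \<bullet> asc C (W \<otimes>\<^sub>o X) Y Z
        = (ident C W \<otimes>\<^sub>a asc C X Y Z) \<bullet> asc C W (X \<otimes>\<^sub>o Y) Z \<bullet> (asc C W X Y \<otimes>\<^sub>a ident C Z)"
    and triangle: "\<lbrakk>X \<in> Obj C; Y \<in> Obj C\<rbrakk>
      \<Longrightarrow> (ident C X \<otimes>\<^sub>a lun C Y) \<bullet> asc C X (munit C) Y = run C X \<otimes>\<^sub>a ident C Y"

text \<open>\<open>D\<close> is a right dual of \<open>X\<close> with evaluation \<open>ev : D \<otimes> X \<rightarrow> I\<close> and coevaluation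
  \<open>coev : I \<rightarrow> X \<otimes> D\<close>; equivalently, \<open>X\<close> is a left dual of \<open>D\<close>. The last two conditions are
  the zig-zag identities, with the constraints of the monoidal category written out.\<close>

definition dual_pair :: "('o, 'a, 'k, 'm) moncat_scheme \<Rightarrow> 'o \<Rightarrow> 'o \<Rightarrow> 'a \<Rightarrow> 'a \<Rightarrow> bool" where
  "dual_pair C D X ev coev \<longleftrightarrow> D \<in> Obj C \<and> X \<in> Obj C \<and>
     ev \<in> homset C (tensO C D X) (munit C) \<and> coev \<in> homset C (munit C) (tensO C X D) \<and>
     run C X \<bullet>\<^bsub>C\<^esub> (ident C X \<otimes>\<^sub>a\<^bsub>C\<^esub> ev) \<bullet>\<^bsub>C\<^esub> asc C X D X \<bullet>\<^bsub>C\<^esub> (coev \<otimes>\<^sub>a\<^bsub>C\<^esub> ident C X)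
       \<bullet>\<^bsub>C\<^esub> inverse_of C (lun C X) = ident C X \<and>
     lun C D \<bullet>\<^bsub>C\<^esub> (ev \<otimes>\<^sub>a\<^bsub>C\<^esub> ident C D) \<bullet>\<^bsub>C\<^esub> inverse_of C (asc C D X D)
       \<bullet>\<^bsub>C\<^esub> (ident C D \<otimes>\<^sub>a\<^bsub>C\<^esub> coev) \<bullet>\<^bsub>C\<^esub> inverse_of C (run C D) = ident C D"

definition rigid :: "('o, 'a, 'k, 'm) moncat_scheme \<Rightarrow> bool" where
  "rigid C \<longleftrightarrow> (\<forall>X\<in>Obj C. (\<exists>D ev coev. dual_pair C D X ev coev) \<and>
     (\<exists>E ev coev. dual_pair C X E ev coev))"

record ('o, 'a, 'k) brmoncat = "('o, 'a, 'k) moncat" +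
  brd :: "'o \<Rightarrow> 'o \<Rightarrow> 'a"

locale braided_monoidal_category = monoidal_category C
  for C :: "('o, 'a, 'k, 'm) brmoncat_scheme" (structure) +
  assumes brd_iso: "\<lbrakk>X \<in> Obj C; Y \<in> Obj C\<rbrakk> \<Longrightarrow> brd C X Y \<in> isos C (X \<otimes>\<^sub>o Y) (Y \<otimes>\<^sub>o X)"
    and brd_natural: "\<lbrakk>f \<in> homset C X X'; g \<in> homset C Y Y'\<rbrakk>
      \<Longrightarrow> brd C X' Y' \<bullet> (f \<otimes>\<^sub>a g) = (g \<otimes>\<^sub>a f) \<bullet> brd C X Y"
    and hexagon1: "\<lbrakk>X \<in> Obj C; Y \<in> Obj C; Z \<in> Obj C\<rbrakk>
      \<Longrightarrow> asc C Y Z X \<bullet> brd C X (Y \<otimes>\<^sub>o Z) \<bullet> asc C X Y Z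
        = (ident C Y \<otimes>\<^sub>a brd C X Z) \<bullet> asc C Y X Z \<bullet> (brd C X Y \<otimes>\<^sub>a ident C Z)"
    and hexagon2: "\<lbrakk>X \<in> Obj C; Y \<in> Obj C; Z \<in> Obj C\<rbrakk>
      \<Longrightarrow> inverse_of C (asc C Z X Y) \<bullet> brd C (X \<otimes>\<^sub>o Y) Z \<bullet> inverse_of C (asc C X Y Z)
        = (brd C X Z \<otimes>\<^sub>a ident C Y) \<bullet> inverse_of C (asc C X Z Y) \<bullet> (ident C X \<otimes>\<^sub>a brd C Y Z)"

locale FRBSU = finite_category K C + braided_monoidal_category C
  for K :: "('k, 'n) ring_scheme" and C :: "('o, 'a, 'k, 'm) brmoncat_scheme" +
  assumes rigid: "rigid C"
    and simple_unit: "simple_object C (munit C)"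

section \<open>Monoidal functors and their transformations\<close>

record ('o, 'a, 'p, 'b) monfunc = "('o, 'a, 'p, 'b) func" +
  gam :: "'o \<times> 'o \<Rightarrow> 'b"
  phi :: "'b"

locale monoidal_functor = A: monoidal_category A + B: monoidal_category B + cat_functor A B F
  for A :: "('o, 'a, 'k, 'm) moncat_scheme" and B :: "('p, 'b, 'l, 'n) moncat_scheme"
  and F :: "('o, 'a, 'p, 'b, 'r) monfunc_scheme" +
  assumes gam_iso: "\<lbrakk>X \<in> Obj A; Y \<in> Obj A\<rbrakk>
      \<Longrightarrow> gam F (X, Y) \<in> isos B (omap F X \<otimes>\<^sub>o\<^bsub>B\<^esub> omap F Y) (omap F (X \<otimes>\<^sub>o\<^bsub>A\<^esub> Y))"
    and gam_natural: "\<lbrakk>f \<in> homset A X X'; g \<in> homset A Y Y'\<rbrakk>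
      \<Longrightarrow> gam F (X', Y') \<bullet>\<^bsub>B\<^esub> (amap F f \<otimes>\<^sub>a\<^bsub>B\<^esub> amap F g)
        = amap F (f \<otimes>\<^sub>a\<^bsub>A\<^esub> g) \<bullet>\<^bsub>B\<^esub> gam F (X, Y)"
    and phi_iso: "phi F \<in> isos B (munit B) (omap F (munit A))"
    and coherence_asc: "\<lbrakk>X \<in> Obj A; Y \<in> Obj A; Z \<in> Obj A\<rbrakk>
      \<Longrightarrow> amap F (asc A X Y Z) \<bullet>\<^bsub>B\<^esub> gam F (X \<otimes>\<^sub>o\<^bsub>A\<^esub> Y, Z)
          \<bullet>\<^bsub>B\<^esub> (gam F (X, Y) \<otimes>\<^sub>a\<^bsub>B\<^esub> ident B (omap F Z))
        = gam F (X, Y \<otimes>\<^sub>o\<^bsub>A\<^esub> Z) \<bullet>\<^bsub>B\<^esub> (ident B (omap F X) \<otimes>\<^sub>a\<^bsub>B\<^esub> gam F (Y, Z))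
          \<bullet>\<^bsub>B\<^esub> asc B (omap F X) (omap F Y) (omap F Z)"
    and coherence_lun: "X \<in> Obj A
      \<Longrightarrow> amap F (lun A X) \<bullet>\<^bsub>B\<^esub> gam F (munit A, X) \<bullet>\<^bsub>B\<^esub> (phi F \<otimes>\<^sub>a\<^bsub>B\<^esub> ident B (omap F X))
        = lun B (omap F X)"
    and coherence_run: "X \<in> Obj A
      \<Longrightarrow> amap F (run A X) \<bullet>\<^bsub>B\<^esub> gam F (X, munit A) \<bullet>\<^bsub>B\<^esub> (ident B (omap F X) \<otimes>\<^sub>a\<^bsub>B\<^esub> phi F)
        = run B (omap F X)"

locale braided_monoidal_functor =
  A: braided_monoidal_category A + B: braided_monoidal_category B + monoidal_functor A B F
  for A :: "('o, 'a, 'k, 'm) brmoncat_scheme" and B :: "('p, 'b, 'l, 'n) brmoncat_scheme"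
  and F :: "('o, 'a, 'p, 'b, 'r) monfunc_scheme" +
  assumes gam_brd: "\<lbrakk>X \<in> Obj A; Y \<in> Obj A\<rbrakk>
      \<Longrightarrow> amap F (brd A X Y) \<bullet>\<^bsub>B\<^esub> gam F (X, Y) = gam F (Y, X) \<bullet>\<^bsub>B\<^esub> brd B (omap F X) (omap F Y)"

locale monoidal_nat_trans =
  F: monoidal_functor A B F + G: monoidal_functor A B G + nat_trans A B F G \<theta>
  for A :: "('o, 'a, 'k, 'm) moncat_scheme" and B :: "('p, 'b, 'l, 'n) moncat_scheme"
  and F :: "('o, 'a, 'p, 'b, 'r) monfunc_scheme" and G :: "('o, 'a, 'p, 'b, 's) monfunc_scheme"
  and \<theta> :: "'o \<Rightarrow> 'b" +
  assumes component_tensor: "\<lbrakk>X \<in> Obj A; Y \<in> Obj A\<rbrakk>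
      \<Longrightarrow> \<theta> (X \<otimes>\<^sub>o\<^bsub>A\<^esub> Y) \<bullet>\<^bsub>B\<^esub> gam F (X, Y) = gam G (X, Y) \<bullet>\<^bsub>B\<^esub> (\<theta> X \<otimes>\<^sub>a\<^bsub>B\<^esub> \<theta> Y)"
    and component_unit: "\<theta> (munit A) \<bullet>\<^bsub>B\<^esub> phi F = phi G"

locale monoidal_nat_iso = monoidal_nat_trans A B F G \<theta>
  for A :: "('o, 'a, 'k, 'm) moncat_scheme" and B :: "('p, 'b, 'l, 'n) moncat_scheme"
  and F :: "('o, 'a, 'p, 'b, 'r) monfunc_scheme" and G :: "('o, 'a, 'p, 'b, 's) monfunc_scheme"
  and \<theta> :: "'o \<Rightarrow> 'b" +
  assumes component_iso: "X \<in> Obj A \<Longrightarrow> \<theta> X \<in> isos B (omap F X) (omap G X)"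

section \<open>Bicategories and 2-categories\<close>

text \<open>\<open>hcat A B\<close> is the category of 1-arrows \<open>A \<rightarrow> B\<close> and 2-arrows between them under vertical
  composition; \<open>hcomp A B C\<close> is the composition functor
  \<open>hcat B C \<times> hcat A B \<rightarrow> hcat A C\<close>, sending \<open>(g, f)\<close> to ``\<open>g\<close> after \<open>f\<close>''.
  The constraints are \<open>basc A B C D h g f : (h g) f \<Rightarrow> h (g f)\<close>, \<open>blun A B f : 1\<^sub>B f \<Rightarrow> f\<close> and
  \<open>brun A B f : f 1\<^sub>A \<Rightarrow> f\<close>.\<close>

record ('c, 'f, 't) bicat =
  Obj0 :: "'c set"
  hcat :: "'c \<Rightarrow> 'c \<Rightarrow> ('f, 't) cat"
  ident1 :: "'c \<Rightarrow> 'f"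
  hcomp :: "'c \<Rightarrow> 'c \<Rightarrow> 'c \<Rightarrow> ('f \<times> 'f, 't \<times> 't, 'f, 't) func"
  basc :: "'c \<Rightarrow> 'c \<Rightarrow> 'c \<Rightarrow> 'c \<Rightarrow> 'f \<Rightarrow> 'f \<Rightarrow> 'f \<Rightarrow> 't"
  blun :: "'c \<Rightarrow> 'c \<Rightarrow> 'f \<Rightarrow> 't"
  brun :: "'c \<Rightarrow> 'c \<Rightarrow> 'f \<Rightarrow> 't"

abbreviation hc1 :: "('c, 'f, 't, 'm) bicat_scheme \<Rightarrow> 'c \<Rightarrow> 'c \<Rightarrow> 'c \<Rightarrow> 'f \<Rightarrow> 'f \<Rightarrow> 'f" where
  "hc1 \<B> A B C g f \<equiv> omap (hcomp \<B> A B C) (g, f)"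

abbreviation hc2 :: "('c, 'f, 't, 'm) bicat_scheme \<Rightarrow> 'c \<Rightarrow> 'c \<Rightarrow> 'c \<Rightarrow> 't \<Rightarrow> 't \<Rightarrow> 't" where
  "hc2 \<B> A B C \<beta> \<alpha> \<equiv> amap (hcomp \<B> A B C) (\<beta>, \<alpha>)"

locale bicategory =
  fixes \<B> :: "('c, 'f, 't, 'm) bicat_scheme"
  assumes hcat_category: "\<lbrakk>A \<in> Obj0 \<B>; B \<in> Obj0 \<B>\<rbrakk> \<Longrightarrow> category (hcat \<B> A B)"
    and ident1_in: "A \<in> Obj0 \<B> \<Longrightarrow> ident1 \<B> A \<in> Obj (hcat \<B> A A)"
    and hcomp_functor: "\<lbrakk>A \<in> Obj0 \<B>; B \<in> Obj0 \<B>; C \<in> Obj0 \<B>\<rbrakk>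
      \<Longrightarrow> cat_functor (prod_cat (hcat \<B> B C) (hcat \<B> A B)) (hcat \<B> A C) (hcomp \<B> A B C)"
    and basc_iso: "\<lbrakk>A \<in> Obj0 \<B>; B \<in> Obj0 \<B>; C \<in> Obj0 \<B>; D \<in> Obj0 \<B>;
        f \<in> Obj (hcat \<B> A B); g \<in> Obj (hcat \<B> B C); h \<in> Obj (hcat \<B> C D)\<rbrakk>
      \<Longrightarrow> basc \<B> A B C D h g f \<in> isos (hcat \<B> A D)
            (hc1 \<B> A B D (hc1 \<B> B C D h g) f) (hc1 \<B> A C D h (hc1 \<B> A B C g f))"
    and blun_iso: "\<lbrakk>A \<in> Obj0 \<B>; B \<in> Obj0 \<B>; f \<in> Obj (hcat \<B> A B)\<rbrakk>
      \<Longrightarrow> blun \<B> A B f \<in> isos (hcat \<B> A B) (hc1 \<B> A B B (ident1 \<B> B) f) f"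
    and brun_iso: "\<lbrakk>A \<in> Obj0 \<B>; B \<in> Obj0 \<B>; f \<in> Obj (hcat \<B> A B)\<rbrakk>
      \<Longrightarrow> brun \<B> A B f \<in> isos (hcat \<B> A B) (hc1 \<B> A A B f (ident1 \<B> A)) f"
    and basc_natural: "\<lbrakk>A \<in> Obj0 \<B>; B \<in> Obj0 \<B>; C \<in> Obj0 \<B>; D \<in> Obj0 \<B>;
        \<alpha> \<in> homset (hcat \<B> A B) f f'; \<beta> \<in> homset (hcat \<B> B C) g g';
        \<gamma> \<in> homset (hcat \<B> C D) h h'\<rbrakk>
      \<Longrightarrow> basc \<B> A B C D h' g' f' \<bullet>\<^bsub>hcat \<B> A D\<^esub> hc2 \<B> A B D (hc2 \<B> B C D \<gamma> \<beta>) \<alpha>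
        = hc2 \<B> A C D \<gamma> (hc2 \<B> A B C \<beta> \<alpha>) \<bullet>\<^bsub>hcat \<B> A D\<^esub> basc \<B> A B C D h g f"
    and blun_natural: "\<lbrakk>A \<in> Obj0 \<B>; B \<in> Obj0 \<B>; \<alpha> \<in> homset (hcat \<B> A B) f f'\<rbrakk>
      \<Longrightarrow> blun \<B> A B f' \<bullet>\<^bsub>hcat \<B> A B\<^esub> hc2 \<B> A B B (ident (hcat \<B> B B) (ident1 \<B> B)) \<alpha>
        = \<alpha> \<bullet>\<^bsub>hcat \<B> A B\<^esub> blun \<B> A B f"
    and brun_natural: "\<lbrakk>A \<in> Obj0 \<B>; B \<in> Obj0 \<B>; \<alpha> \<in> homset (hcat \<B> A B) f f'\<rbrakk>
      \<Longrightarrow> brun \<B> A B f' \<bullet>\<^bsub>hcat \<B> A B\<^esub> hc2 \<B> A A B \<alpha> (ident (hcat \<B> A A) (ident1 \<B> A))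
        = \<alpha> \<bullet>\<^bsub>hcat \<B> A B\<^esub> brun \<B> A B f"
    and bicat_pentagon: "\<lbrakk>A \<in> Obj0 \<B>; B \<in> Obj0 \<B>; C \<in> Obj0 \<B>; D \<in> Obj0 \<B>; E \<in> Obj0 \<B>;
        f \<in> Obj (hcat \<B> A B); g \<in> Obj (hcat \<B> B C); h \<in> Obj (hcat \<B> C D);
        k \<in> Obj (hcat \<B> D E)\<rbrakk>
      \<Longrightarrow> basc \<B> A C D E k h (hc1 \<B> A B C g f) \<bullet>\<^bsub>hcat \<B> A E\<^esub>
          basc \<B> A B C E (hc1 \<B> C D E k h) g f
        = hc2 \<B> A D E (ident (hcat \<B> D E) k) (basc \<B> A B C D h g f) \<bullet>\<^bsub>hcat \<B> A E\<^esub>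
          basc \<B> A B D E k (hc1 \<B> B C D h g) f \<bullet>\<^bsub>hcat \<B> A E\<^esub>
          hc2 \<B> A B E (basc \<B> B C D E k h g) (ident (hcat \<B> A B) f)"
    and bicat_triangle: "\<lbrakk>A \<in> Obj0 \<B>; B \<in> Obj0 \<B>; C \<in> Obj0 \<B>;
        f \<in> Obj (hcat \<B> A B); g \<in> Obj (hcat \<B> B C)\<rbrakk>
      \<Longrightarrow> hc2 \<B> A B C (ident (hcat \<B> B C) g) (blun \<B> A B f) \<bullet>\<^bsub>hcat \<B> A C\<^esub>
          basc \<B> A B B C g (ident1 \<B> B) f
        = hc2 \<B> A B C (brun \<B> B C g) (ident (hcat \<B> A B) f)"

text \<open>Strict associativity and unitality of horizontal composition of 2-arrows follow from the
  naturality of the identity constraints.\<close>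

locale two_category = bicategory \<B>
  for \<B> :: "('c, 'f, 't, 'm) bicat_scheme" +
  assumes strict_assoc: "\<lbrakk>A \<in> Obj0 \<B>; B \<in> Obj0 \<B>; C \<in> Obj0 \<B>; D \<in> Obj0 \<B>;
        f \<in> Obj (hcat \<B> A B); g \<in> Obj (hcat \<B> B C); h \<in> Obj (hcat \<B> C D)\<rbrakk>
      \<Longrightarrow> hc1 \<B> A B D (hc1 \<B> B C D h g) f = hc1 \<B> A C D h (hc1 \<B> A B C g f) \<and>
          basc \<B> A B C D h g f = ident (hcat \<B> A D) (hc1 \<B> A C D h (hc1 \<B> A B C g f))"
    and strict_left_unit: "\<lbrakk>A \<in> Obj0 \<B>; B \<in> Obj0 \<B>; f \<in> Obj (hcat \<B> A B)\<rbrakk>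
      \<Longrightarrow> hc1 \<B> A B B (ident1 \<B> B) f = f \<and> blun \<B> A B f = ident (hcat \<B> A B) f"
    and strict_right_unit: "\<lbrakk>A \<in> Obj0 \<B>; B \<in> Obj0 \<B>; f \<in> Obj (hcat \<B> A B)\<rbrakk>
      \<Longrightarrow> hc1 \<B> A A B f (ident1 \<B> A) = f \<and> brun \<B> A B f = ident (hcat \<B> A B) f"

section \<open>The 2-category of FRBSU monoidal categories\<close>

text \<open>The data of a functor or transformation outside its domain is meaningless, so it is
  normalized by \<open>extensional\<close> and \<open>restrict\<close>: then HOL equality of 1-arrows and of 2-arrows
  is equality of the mathematical objects.\<close>

definition braided_functors :: "('o, 'a, 'k) brmoncat \<Rightarrow> ('o, 'a, 'k) brmoncat
    \<Rightarrow> ('o, 'a, 'o, 'a) monfunc set" where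
  "braided_functors A B = {F. braided_monoidal_functor A B F \<and>
     omap F \<in> extensional (Obj A) \<and> amap F \<in> extensional (Arr A) \<and>
     gam F \<in> extensional (Obj A \<times> Obj A)}"

definition id_monfunc :: "('o, 'a, 'k) brmoncat \<Rightarrow> ('o, 'a, 'o, 'a) monfunc" where
  "id_monfunc A = \<lparr>
     omap = (\<lambda>X\<in>Obj A. X),
     amap = (\<lambda>f\<in>Arr A. f),
     gam = (\<lambda>(X, Y)\<in>Obj A \<times> Obj A. ident A (X \<otimes>\<^sub>o\<^bsub>A\<^esub> Y)),
     phi = ident A (munit A)\<rparr>"

definition comp_monfunc :: "('o, 'a, 'k) brmoncat \<Rightarrow> ('o, 'a, 'k) brmoncat
    \<Rightarrow> ('o, 'a, 'o, 'a) monfunc \<Rightarrow> ('o, 'a, 'o, 'a) monfunc \<Rightarrow> ('o, 'a, 'o, 'a) monfunc" where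
  "comp_monfunc A C F G = \<lparr>
     omap = (\<lambda>X\<in>Obj A. omap F (omap G X)),
     amap = (\<lambda>f\<in>Arr A. amap F (amap G f)),
     gam = (\<lambda>(X, Y)\<in>Obj A \<times> Obj A. amap F (gam G (X, Y)) \<bullet>\<^bsub>C\<^esub> gam F (omap G X, omap G Y)),
     phi = amap F (phi G) \<bullet>\<^bsub>C\<^esub> phi F\<rparr>"

record ('o, 'a) ntrans =
  nsrc :: "('o, 'a, 'o, 'a) monfunc"
  ntgt :: "('o, 'a, 'o, 'a) monfunc"
  ncomp :: "'o \<Rightarrow> 'a"

definition MCT_hom :: "('o, 'a, 'k) brmoncat \<Rightarrow> ('o, 'a, 'k) brmoncat
    \<Rightarrow> (('o, 'a, 'o, 'a) monfunc, ('o, 'a) ntrans) cat" where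
  "MCT_hom A B = \<lparr>
     Obj = braided_functors A B,
     Arr = {\<theta>. nsrc \<theta> \<in> braided_functors A B \<and> ntgt \<theta> \<in> braided_functors A B \<and>
              monoidal_nat_iso A B (nsrc \<theta>) (ntgt \<theta>) (ncomp \<theta>) \<and> ncomp \<theta> \<in> extensional (Obj A)},
     src = nsrc,
     tgt = ntgt,
     ident = (\<lambda>F. \<lparr>nsrc = F, ntgt = F, ncomp = (\<lambda>X\<in>Obj A. ident B (omap F X))\<rparr>),
     cmp = (\<lambda>\<theta> \<eta>. \<lparr>nsrc = nsrc \<eta>, ntgt = ntgt \<theta>,
                    ncomp = (\<lambda>X\<in>Obj A. ncomp \<theta> X \<bullet>\<^bsub>B\<^esub> ncomp \<eta> X)\<rparr>)\<rparr>"

definition MCT_hcomp :: "('o, 'a, 'k) brmoncat \<Rightarrow> ('o, 'a, 'k) brmoncat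
    \<Rightarrow> (('o, 'a, 'o, 'a) monfunc \<times> ('o, 'a, 'o, 'a) monfunc,
        ('o, 'a) ntrans \<times> ('o, 'a) ntrans, ('o, 'a, 'o, 'a) monfunc, ('o, 'a) ntrans) func" where
  "MCT_hcomp A C = \<lparr>
     omap = (\<lambda>(F, G). comp_monfunc A C F G),
     amap = (\<lambda>(\<theta>, \<eta>). \<lparr>nsrc = comp_monfunc A C (nsrc \<theta>) (nsrc \<eta>),
                        ntgt = comp_monfunc A C (ntgt \<theta>) (ntgt \<eta>),
                        ncomp = (\<lambda>X\<in>Obj A. ncomp \<theta> (omap (ntgt \<eta>) X)
                                   \<bullet>\<^bsub>C\<^esub> amap (nsrc \<theta>) (ncomp \<eta> X))\<rparr>)\<rparr>"

definition MCT :: "('k, 'n) ring_scheme \<Rightarrow>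
    (('o, 'a, 'k) brmoncat, ('o, 'a, 'o, 'a) monfunc, ('o, 'a) ntrans) bicat" where
  "MCT K = \<lparr>
     Obj0 = {A. FRBSU K A},
     hcat = MCT_hom,
     ident1 = id_monfunc,
     hcomp = (\<lambda>A B C. MCT_hcomp A C),
     basc = (\<lambda>A B C D H G F. ident (MCT_hom A D) (comp_monfunc A D H (comp_monfunc A C G F))),
     blun = (\<lambda>A B F. ident (MCT_hom A B) F),
     brun = (\<lambda>A B F. ident (MCT_hom A B) F)\<rparr>"

end

theory Submission
  imports Defs
begin

text \<open>
  A braided monoidal functor is a functor together with structure isomorphisms \<open>gam\<close> and \<open>phi\<close>.
  All diagrams required of a composite \<open>F \<circ> G\<close> commute for the same reason: the structure map of
  \<open>F \<circ> G\<close> is that of \<open>F\<close> followed by \<open>F\<close> of that of \<open>G\<close>. Naturality of the structure map of \<open>F\<close>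
  moves it past arrows in the image of \<open>F\<close>, so a diagram for \<open>F \<circ> G\<close> splits into \<open>F\<close> of the diagram
  for \<open>G\<close> pasted to the diagram for \<open>F\<close> at objects in the image of \<open>G\<close>. This gives closure of braided monoidal functors under composition
  (\<open>monoidal_functor_comp\<close>, \<open>braided_monoidal_functor_comp\<close>). The same pasting shows that the
  horizontal composite of \<open>\<theta> : F \<Rightarrow> F'\<close> and \<open>\<eta> : G \<Rightarrow> G'\<close>, with components
  \<open>\<theta> (G' X) \<bullet> F (\<eta> X)\<close>, is monoidal and invertible (\<open>monoidal_nat_iso_hcomp\<close>); for vertical composites
  the squares are simply stacked (\<open>monoidal_nat_iso_vcomp\<close>).

  Hence 1-arrows and 2-arrows with fixed ends form a category (\<open>category_MCT_hom\<close>), and horizontal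
  composition is a functor (\<open>cat_functor_MCT_hcomp\<close>), the interchange law being one naturality square
  of \<open>\<theta>\<close> at a component of a second transformation. Strictness comes from the strictness of the
  composition of functions: on objects and arrows the two ways of bracketing a composite of functors
  are the same function, and on structure maps they agree because functors preserve composition.
  Once the laws hold as equalities of 1-arrows (\<open>comp_monfunc_assoc\<close>, \<open>comp_monfunc_id_left\<close>,
  \<open>comp_monfunc_id_right\<close>) and of 2-arrows (\<open>MCT_hcomp_assoc\<close>, \<open>MCT_hcomp_units\<close>), the
  constraints can be identity 2-arrows: their naturality is then the laws for 2-arrows, and the
  pentagon and the triangle are equations between composites of identities.
\<close>

section \<open>Composing arrows and isomorphisms\<close>

text \<open>
  Rewriting needs the side condition ``composable'' in a form that is itself decided by rewriting.
  Membership in \<open>homset C X Y\<close> mentions objects that do not occur in the composite, whereas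
  membership in \<open>Arr C\<close> and equations between sources and targets can be computed from the arrows.
  So the laws of a category, and below those of tensor products and functors, are first put into
  this form. As simplification rules they bracket composites to the right.
\<close>

context category
begin

lemma src_obj [simp]: "f \<in> Arr C \<Longrightarrow> src C f \<in> Obj C"
  by (rule src_in)

lemma tgt_obj [simp]: "f \<in> Arr C \<Longrightarrow> tgt C f \<in> Obj C"
  by (rule tgt_in)

lemma ident_arr [simp]:
  assumes "X \<in> Obj C"
  shows "ident C X \<in> Arr C" "src C (ident C X) = X" "tgt C (ident C X) = X"
  using ident_in[OF assms] by (auto simp: homset_def)

lemma cmp_arr [simp]:
  assumes "f \<in> Arr C" "g \<in> Arr C" "src C g = tgt C f"
  shows "g \<bullet> f \<in> Arr C" "src C (g \<bullet> f) = src C f" "tgt C (g \<bullet> f) = tgt C g"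
  using assms cmp_in[of f "src C f" "tgt C f" g "tgt C g"] by (auto simp: homset_def)

lemma cmp_ident_arr [simp]:
  assumes "f \<in> Arr C"
  shows "tgt C f = Y \<Longrightarrow> ident C Y \<bullet> f = f" "src C f = X \<Longrightarrow> f \<bullet> ident C X = f"
  using assms cmp_ident_left[of f "src C f" "tgt C f"] cmp_ident_right[of f "src C f" "tgt C f"]
  by (auto simp: homset_def)

lemma cmp_assoc_arr [simp]:
  assumes "f \<in> Arr C" "g \<in> Arr C" "h \<in> Arr C" "src C g = tgt C f" "src C h = tgt C g"
  shows "(h \<bullet> g) \<bullet> f = h \<bullet> (g \<bullet> f)"
  using assms cmp_assoc[of f "src C f" "tgt C f" g "tgt C g" h "tgt C h"]
  by (auto simp: homset_def)

text \<open>
  In a composite bracketed to the right, \<open>g \<bullet> f\<close> is a subterm only at the end; this form of a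
  commuting square applies anywhere else.
\<close>

lemma cmp_square:
  assumes "g \<bullet> f = k \<bullet> h" "g \<in> Arr C" "f \<in> Arr C" "k \<in> Arr C" "h \<in> Arr C"
    "src C g = tgt C f" "src C k = tgt C h" "x \<in> Arr C" "src C f = tgt C x" "src C h = tgt C x"
  shows "g \<bullet> f \<bullet> x = k \<bullet> h \<bullet> x"
  using assms cmp_assoc_arr by metis

lemma isos_arr:
  assumes "f \<in> isos C X Y"
  shows "f \<in> Arr C" "src C f = X" "tgt C f = Y"
  using assms by (auto simp: isos_def homset_def)

lemma isosI:
  assumes "f \<in> Arr C" "g \<in> Arr C" "src C f = X" "tgt C f = Y" "src C g = Y" "tgt C g = X"
    "g \<bullet> f = ident C X" "f \<bullet> g = ident C Y"
  shows "f \<in> isos C X Y"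
  using assms by (auto simp: isos_def inverse_arrows_def homset_def)

lemma isosE:
  assumes "f \<in> isos C X Y"
  obtains g where "g \<in> Arr C" "src C g = Y" "tgt C g = X"
    "g \<bullet> f = ident C X" "f \<bullet> g = ident C Y"
  using assms by (auto simp: isos_def inverse_arrows_def homset_def)

lemma ident_isos: "X \<in> Obj C \<Longrightarrow> ident C X \<in> isos C X X"
  by (rule isosI[where g = "ident C X"]) auto

lemma cmp_isos:
  assumes "f \<in> isos C X Y" "g \<in> isos C Y Z"
  shows "g \<bullet> f \<in> isos C X Z"
proof -
  note [simp] = isos_arr[OF assms(1)] isos_arr[OF assms(2)]
  obtain f' where f' [simp]: "f' \<in> Arr C" "src C f' = Y" "tgt C f' = X"
      "f' \<bullet> f = ident C X" "f \<bullet> f' = ident C Y"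
    using isosE[OF assms(1)] .
  obtain g' where g' [simp]: "g' \<in> Arr C" "src C g' = Z" "tgt C g' = Y"
      "g' \<bullet> g = ident C Y" "g \<bullet> g' = ident C Z"
    using isosE[OF assms(2)] .
  have "g' \<bullet> g \<bullet> f = f"
    using cmp_assoc_arr[of f g g'] by simp
  moreover have "f \<bullet> f' \<bullet> g' = g'"
    using cmp_assoc_arr[of g' f' f] by simp
  ultimately show ?thesis
    by (intro isosI[where g = "f' \<bullet> g'"]) auto
qed

end

context monoidal_category
begin

interpretation T: cat_functor "prod_cat C C" C "tensor_func C"
  by (rule tensor_functor)

lemma tensO_obj [simp]: "X \<in> Obj C \<Longrightarrow> Y \<in> Obj C \<Longrightarrow> X \<otimes>\<^sub>o Y \<in> Obj C"
  using T.omap_in[of "(X, Y)"] by (simp add: prod_cat_def tensor_func_def)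

lemma tensA_arr [simp]:
  assumes "f \<in> Arr C" "g \<in> Arr C"
  shows "f \<otimes>\<^sub>a g \<in> Arr C" "src C (f \<otimes>\<^sub>a g) = src C f \<otimes>\<^sub>o src C g"
    "tgt C (f \<otimes>\<^sub>a g) = tgt C f \<otimes>\<^sub>o tgt C g"
  using assms T.amap_in[of "(f, g)" "(src C f, src C g)" "(tgt C f, tgt C g)"]
  by (auto simp: prod_cat_def tensor_func_def homset_def)

lemma tensA_ident [simp]:
  "X \<in> Obj C \<Longrightarrow> Y \<in> Obj C \<Longrightarrow> ident C X \<otimes>\<^sub>a ident C Y = ident C (X \<otimes>\<^sub>o Y)"
  using T.amap_ident[of "(X, Y)"] by (simp add: prod_cat_def tensor_func_def)

text \<open>
  Functoriality of \<open>\<otimes>\<close>. It is not a default simplification rule: the proofs below split a composite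
  inside a tensor factor in order to apply naturality to one part of it, and merging the factors
  would undo that.
\<close>

lemma tensA_cmp:
  assumes "f \<in> Arr C" "g \<in> Arr C" "f' \<in> Arr C" "g' \<in> Arr C"
    "src C g = tgt C f" "src C g' = tgt C f'"
  shows "(g \<otimes>\<^sub>a g') \<bullet> (f \<otimes>\<^sub>a f') = (g \<bullet> f) \<otimes>\<^sub>a (g' \<bullet> f')"
  using assms T.amap_cmp[of "(f, f')" "(src C f, src C f')" "(tgt C f, tgt C f')"
      "(g, g')" "(tgt C g, tgt C g')"]
  by (auto simp: prod_cat_def tensor_func_def homset_def)

lemma unit_obj [simp]: "munit C \<in> Obj C"
  by (rule unit_in)

lemma asc_arr [simp]:
  assumes "X \<in> Obj C" "Y \<in> Obj C" "Z \<in> Obj C"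
  shows "asc C X Y Z \<in> Arr C" "src C (asc C X Y Z) = (X \<otimes>\<^sub>o Y) \<otimes>\<^sub>o Z"
    "tgt C (asc C X Y Z) = X \<otimes>\<^sub>o (Y \<otimes>\<^sub>o Z)"
  using isos_arr[OF asc_iso[OF assms]] by auto

lemma lun_arr [simp]:
  assumes "X \<in> Obj C"
  shows "lun C X \<in> Arr C" "src C (lun C X) = munit C \<otimes>\<^sub>o X" "tgt C (lun C X) = X"
  using isos_arr[OF lun_iso[OF assms]] by auto

lemma run_arr [simp]:
  assumes "X \<in> Obj C"
  shows "run C X \<in> Arr C" "src C (run C X) = X \<otimes>\<^sub>o munit C" "tgt C (run C X) = X"
  using isos_arr[OF run_iso[OF assms]] by auto

end

lemma (in braided_monoidal_category) brd_arr [simp]: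
  assumes "X \<in> Obj C" "Y \<in> Obj C"
  shows "brd C X Y \<in> Arr C" "src C (brd C X Y) = X \<otimes>\<^sub>o Y" "tgt C (brd C X Y) = Y \<otimes>\<^sub>o X"
  using isos_arr[OF brd_iso[OF assms]] by auto

context cat_functor
begin

lemma omap_obj [simp]: "X \<in> Obj A \<Longrightarrow> omap F X \<in> Obj B"
  by (rule omap_in)

lemma amap_arr [simp]:
  assumes "f \<in> Arr A"
  shows "amap F f \<in> Arr B" "src B (amap F f) = omap F (src A f)"
    "tgt B (amap F f) = omap F (tgt A f)"
  using assms amap_in[of f "src A f" "tgt A f"] by (auto simp: homset_def)

declare amap_ident [simp]

text \<open>
  Again not a default simplification rule: a diagram in the source category has to be kept together
  under \<open>F\<close> until the hypothesis that makes it commute has been applied.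
\<close>

lemma amap_cmp_arr:
  assumes "f \<in> Arr A" "g \<in> Arr A" "src A g = tgt A f"
  shows "amap F (g \<bullet>\<^bsub>A\<^esub> f) = amap F g \<bullet>\<^bsub>B\<^esub> amap F f"
  using assms amap_cmp[of f "src A f" "tgt A f" g "tgt A g"] by (auto simp: homset_def)

lemma amap_isos:
  assumes "f \<in> isos A X Y"
  shows "amap F f \<in> isos B (omap F X) (omap F Y)"
proof -
  note [simp] = A.isos_arr[OF assms]
  obtain g where [simp]: "g \<in> Arr A" "src A g = Y" "tgt A g = X"
      "g \<bullet>\<^bsub>A\<^esub> f = ident A X" "f \<bullet>\<^bsub>A\<^esub> g = ident A Y"
    using A.isosE[OF assms] .
  have "X \<in> Obj A" "Y \<in> Obj A"
    using A.src_obj[of f] A.tgt_obj[of f] by auto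
  then show ?thesis
    by (intro B.isosI[where g = "amap F g"]) (auto simp flip: amap_cmp_arr)
qed

end

context nat_trans
begin

lemma component_arr [simp]:
  assumes "X \<in> Obj A"
  shows "\<theta> X \<in> Arr B" "src B (\<theta> X) = omap F X" "tgt B (\<theta> X) = omap G X"
  using component_in[OF assms] by (auto simp: homset_def)

lemma naturality_arr:
  assumes "f \<in> Arr A" "src A f = X" "tgt A f = Y"
  shows "\<theta> Y \<bullet>\<^bsub>B\<^esub> amap F f = amap G f \<bullet>\<^bsub>B\<^esub> \<theta> X"
  using assms naturality by (auto simp: homset_def)

end

context monoidal_functor
begin

lemma gam_arr [simp]:
  assumes "X \<in> Obj A" "Y \<in> Obj A"
  shows "gam F (X, Y) \<in> Arr B" "src B (gam F (X, Y)) = omap F X \<otimes>\<^sub>o\<^bsub>B\<^esub> omap F Y"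
    "tgt B (gam F (X, Y)) = omap F (X \<otimes>\<^sub>o\<^bsub>A\<^esub> Y)"
  using B.isos_arr[OF gam_iso[OF assms]] by auto

lemma phi_arr [simp]:
  "phi F \<in> Arr B" "src B (phi F) = munit B" "tgt B (phi F) = omap F (munit A)"
  using B.isos_arr[OF phi_iso] by auto

lemma gam_natural_arr:
  assumes "f \<in> Arr A" "g \<in> Arr A" "src A f = X" "tgt A f = X'" "src A g = Y" "tgt A g = Y'"
  shows "gam F (X', Y') \<bullet>\<^bsub>B\<^esub> (amap F f \<otimes>\<^sub>a\<^bsub>B\<^esub> amap F g)
    = amap F (f \<otimes>\<^sub>a\<^bsub>A\<^esub> g) \<bullet>\<^bsub>B\<^esub> gam F (X, Y)"
  using assms gam_natural by (auto simp: homset_def)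

end

section \<open>Identities and composites of braided monoidal functors\<close>

lemma id_monfunc_simps [simp]:
  "X \<in> Obj A \<Longrightarrow> omap (id_monfunc A) X = X"
  "f \<in> Arr A \<Longrightarrow> amap (id_monfunc A) f = f"
  "X \<in> Obj A \<Longrightarrow> Y \<in> Obj A \<Longrightarrow> gam (id_monfunc A) (X, Y) = ident A (X \<otimes>\<^sub>o\<^bsub>A\<^esub> Y)"
  "phi (id_monfunc A) = ident A (munit A)"
  by (simp_all add: id_monfunc_def)

lemma comp_monfunc_simps [simp]:
  "X \<in> Obj A \<Longrightarrow> omap (comp_monfunc A C F G) X = omap F (omap G X)"
  "f \<in> Arr A \<Longrightarrow> amap (comp_monfunc A C F G) f = amap F (amap G f)"
  "X \<in> Obj A \<Longrightarrow> Y \<in> Obj A \<Longrightarrow> gam (comp_monfunc A C F G) (X, Y)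
     = amap F (gam G (X, Y)) \<bullet>\<^bsub>C\<^esub> gam F (omap G X, omap G Y)"
  "phi (comp_monfunc A C F G) = amap F (phi G) \<bullet>\<^bsub>C\<^esub> phi F"
  by (simp_all add: comp_monfunc_def)

lemma monoidal_functor_id:
  assumes "monoidal_category (A :: ('o, 'a, 'k) brmoncat)"
  shows "monoidal_functor A A (id_monfunc A)"
proof -
  interpret A: monoidal_category A by fact
  show ?thesis
    by unfold_locales (auto simp: homset_def A.ident_isos)
qed

lemma braided_monoidal_functor_id:
  assumes "braided_monoidal_category (A :: ('o, 'a, 'k) brmoncat)"
  shows "braided_monoidal_functor A A (id_monfunc A)"
proof -
  interpret A: braided_monoidal_category A by fact
  interpret monoidal_functor A A "id_monfunc A"
    by (rule monoidal_functor_id) unfold_locales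
  show ?thesis
    by unfold_locales auto
qed

lemma cat_functor_comp:
  assumes "cat_functor B C F" "cat_functor (A :: ('o, 'a, 'k) brmoncat) B G"
  shows "cat_functor A C (comp_monfunc A C F G)"
proof -
  interpret F: cat_functor B C F by fact
  interpret G: cat_functor A B G by fact
  show ?thesis
    by unfold_locales (auto simp: homset_def F.amap_cmp_arr G.amap_cmp_arr)
qed

text \<open>
  Writing \<open>f\<close>, \<open>g\<close> for the maps \<open>gam\<close> of \<open>F\<close>, \<open>G\<close>, the associativity diagram of \<open>F \<circ> G\<close> is
  the diagram for \<open>G\<close> under \<open>F\<close> pasted to the diagram for \<open>F\<close> at the objects \<open>G X\<close>, \<open>G Y\<close>, \<open>G Z\<close>.
  The two are glued along the naturality squares of \<open>f\<close> at \<open>g \<otimes> id\<close> and at \<open>id \<otimes> g\<close>; in these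
  squares the identity of \<open>F (G Z)\<close> has to be read as \<open>F\<close> of the identity of \<open>G Z\<close>. For the unit
  diagrams the gluing square is that of \<open>f\<close> at \<open>phi G \<otimes> id\<close> or \<open>id \<otimes> phi G\<close>.
\<close>

lemma monoidal_functor_comp:
  fixes A B C :: "('o, 'a, 'k) brmoncat"
  assumes "monoidal_functor B C F" "monoidal_functor A B G"
  shows "monoidal_functor A C (comp_monfunc A C F G)"
proof -
  interpret F: monoidal_functor B C F by fact
  interpret G: monoidal_functor A B G by fact
  interpret cat_functor A C "comp_monfunc A C F G"
    by (rule cat_functor_comp) unfold_locales
  show ?thesis
  proof unfold_locales
    fix X Y assume [simp]: "X \<in> Obj A" "Y \<in> Obj A"
    show "gam (comp_monfunc A C F G) (X, Y) \<in> isos C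
        (omap (comp_monfunc A C F G) X \<otimes>\<^sub>o\<^bsub>C\<^esub> omap (comp_monfunc A C F G) Y)
        (omap (comp_monfunc A C F G) (X \<otimes>\<^sub>o\<^bsub>A\<^esub> Y))"
      by (auto intro!: F.B.cmp_isos F.gam_iso F.amap_isos G.gam_iso)
  next
    show "phi (comp_monfunc A C F G)
        \<in> isos C (munit C) (omap (comp_monfunc A C F G) (munit A))"
      by (auto intro!: F.B.cmp_isos F.phi_iso F.amap_isos G.phi_iso)
  next
    fix f g X X' Y Y' assume "f \<in> homset A X X'" "g \<in> homset A Y Y'"
    then have [simp]: "f \<in> Arr A" "src A f = X" "tgt A f = X'"
        "g \<in> Arr A" "src A g = Y" "tgt A g = Y'"
      by (auto simp: homset_def)
    have [simp]: "X \<in> Obj A" "X' \<in> Obj A" "Y \<in> Obj A" "Y' \<in> Obj A"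
      using G.A.src_obj[of f] G.A.tgt_obj[of f] G.A.src_obj[of g] G.A.tgt_obj[of g] by auto
    have "amap F (gam G (X', Y')) \<bullet>\<^bsub>C\<^esub> gam F (omap G X', omap G Y')
          \<bullet>\<^bsub>C\<^esub> (amap F (amap G f) \<otimes>\<^sub>a\<^bsub>C\<^esub> amap F (amap G g))
        = amap F (gam G (X', Y') \<bullet>\<^bsub>B\<^esub> (amap G f \<otimes>\<^sub>a\<^bsub>B\<^esub> amap G g))
          \<bullet>\<^bsub>C\<^esub> gam F (omap G X, omap G Y)"
      by (simp add: F.gam_natural_arr F.amap_cmp_arr)
    also have "\<dots> = amap F (amap G (f \<otimes>\<^sub>a\<^bsub>A\<^esub> g))
        \<bullet>\<^bsub>C\<^esub> amap F (gam G (X, Y)) \<bullet>\<^bsub>C\<^esub> gam F (omap G X, omap G Y)"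
      by (simp add: G.gam_natural_arr F.amap_cmp_arr)
    finally show "gam (comp_monfunc A C F G) (X', Y') \<bullet>\<^bsub>C\<^esub>
        (amap (comp_monfunc A C F G) f \<otimes>\<^sub>a\<^bsub>C\<^esub> amap (comp_monfunc A C F G) g)
        = amap (comp_monfunc A C F G) (f \<otimes>\<^sub>a\<^bsub>A\<^esub> g) \<bullet>\<^bsub>C\<^esub> gam (comp_monfunc A C F G) (X, Y)"
      by simp
  next
    fix X Y Z assume [simp]: "X \<in> Obj A" "Y \<in> Obj A" "Z \<in> Obj A"
    let ?f = "\<lambda>U V. gam F (U, V)" and ?g = "\<lambda>U V. gam G (U, V)"
    let ?X = "omap G X" and ?Y = "omap G Y" and ?Z = "omap G Z"
    let ?idX = "ident C (omap F (omap G X))" and ?idZ = "ident C (omap F (omap G Z))"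
    \<comment> \<open>The structure map of the composite, tensored with an identity, is cut into its part from \<open>G\<close>,
      written as a value of \<open>F\<close> on both factors so that \<open>f\<close> is natural at it, and its part from \<open>F\<close>.\<close>
    have splitL: "(amap F (?g X Y) \<bullet>\<^bsub>C\<^esub> ?f ?X ?Y) \<otimes>\<^sub>a\<^bsub>C\<^esub> ?idZ
        = (amap F (?g X Y) \<otimes>\<^sub>a\<^bsub>C\<^esub> amap F (ident B ?Z)) \<bullet>\<^bsub>C\<^esub> (?f ?X ?Y \<otimes>\<^sub>a\<^bsub>C\<^esub> ?idZ)"
      by (simp add: F.B.tensA_cmp)
    have splitR: "?idX \<otimes>\<^sub>a\<^bsub>C\<^esub> (amap F (?g Y Z) \<bullet>\<^bsub>C\<^esub> ?f ?Y ?Z)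
        = (amap F (ident B ?X) \<otimes>\<^sub>a\<^bsub>C\<^esub> amap F (?g Y Z)) \<bullet>\<^bsub>C\<^esub> (?idX \<otimes>\<^sub>a\<^bsub>C\<^esub> ?f ?Y ?Z)"
      by (simp add: F.B.tensA_cmp)
    have natL: "?f (omap G (X \<otimes>\<^sub>o\<^bsub>A\<^esub> Y)) ?Z \<bullet>\<^bsub>C\<^esub> (amap F (?g X Y) \<otimes>\<^sub>a\<^bsub>C\<^esub> amap F (ident B ?Z))
        = amap F (?g X Y \<otimes>\<^sub>a\<^bsub>B\<^esub> ident B ?Z) \<bullet>\<^bsub>C\<^esub> ?f (?X \<otimes>\<^sub>o\<^bsub>B\<^esub> ?Y) ?Z"
      by (rule F.gam_natural_arr) auto
    have natR: "?f ?X (omap G (Y \<otimes>\<^sub>o\<^bsub>A\<^esub> Z)) \<bullet>\<^bsub>C\<^esub> (amap F (ident B ?X) \<otimes>\<^sub>a\<^bsub>C\<^esub> amap F (?g Y Z))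
        = amap F (ident B ?X \<otimes>\<^sub>a\<^bsub>B\<^esub> ?g Y Z) \<bullet>\<^bsub>C\<^esub> ?f ?X (?Y \<otimes>\<^sub>o\<^bsub>B\<^esub> ?Z)"
      by (rule F.gam_natural_arr) auto
    have "amap F (amap G (asc A X Y Z)) \<bullet>\<^bsub>C\<^esub> (amap F (?g (X \<otimes>\<^sub>o\<^bsub>A\<^esub> Y) Z)
          \<bullet>\<^bsub>C\<^esub> ?f (omap G (X \<otimes>\<^sub>o\<^bsub>A\<^esub> Y)) ?Z)
          \<bullet>\<^bsub>C\<^esub> ((amap F (?g X Y) \<bullet>\<^bsub>C\<^esub> ?f ?X ?Y) \<otimes>\<^sub>a\<^bsub>C\<^esub> ?idZ)
        = amap F (amap G (asc A X Y Z)) \<bullet>\<^bsub>C\<^esub> amap F (?g (X \<otimes>\<^sub>o\<^bsub>A\<^esub> Y) Z)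
          \<bullet>\<^bsub>C\<^esub> (?f (omap G (X \<otimes>\<^sub>o\<^bsub>A\<^esub> Y)) ?Z \<bullet>\<^bsub>C\<^esub> (amap F (?g X Y) \<otimes>\<^sub>a\<^bsub>C\<^esub> amap F (ident B ?Z)))
          \<bullet>\<^bsub>C\<^esub> (?f ?X ?Y \<otimes>\<^sub>a\<^bsub>C\<^esub> ?idZ)"
      unfolding splitL by simp
    also have "\<dots> = amap F (amap G (asc A X Y Z) \<bullet>\<^bsub>B\<^esub> ?g (X \<otimes>\<^sub>o\<^bsub>A\<^esub> Y) Z \<bullet>\<^bsub>B\<^esub> (?g X Y \<otimes>\<^sub>a\<^bsub>B\<^esub> ident B ?Z))
          \<bullet>\<^bsub>C\<^esub> ?f (?X \<otimes>\<^sub>o\<^bsub>B\<^esub> ?Y) ?Z \<bullet>\<^bsub>C\<^esub> (?f ?X ?Y \<otimes>\<^sub>a\<^bsub>C\<^esub> ?idZ)"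
      unfolding natL by (simp add: F.amap_cmp_arr)
    \<comment> \<open>Everything under \<open>F\<close> is now one side of the diagram for \<open>G\<close>.\<close>
    also have "\<dots> = amap F (?g X (Y \<otimes>\<^sub>o\<^bsub>A\<^esub> Z) \<bullet>\<^bsub>B\<^esub> (ident B ?X \<otimes>\<^sub>a\<^bsub>B\<^esub> ?g Y Z) \<bullet>\<^bsub>B\<^esub> asc B ?X ?Y ?Z)
          \<bullet>\<^bsub>C\<^esub> ?f (?X \<otimes>\<^sub>o\<^bsub>B\<^esub> ?Y) ?Z \<bullet>\<^bsub>C\<^esub> (?f ?X ?Y \<otimes>\<^sub>a\<^bsub>C\<^esub> ?idZ)"
      by (simp add: G.coherence_asc)
    \<comment> \<open>The image of the associator of \<open>B\<close> now meets the structure maps of \<open>F\<close>, which is one side of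
      the diagram for \<open>F\<close>.\<close>
    also have "\<dots> = amap F (?g X (Y \<otimes>\<^sub>o\<^bsub>A\<^esub> Z)) \<bullet>\<^bsub>C\<^esub> amap F (ident B ?X \<otimes>\<^sub>a\<^bsub>B\<^esub> ?g Y Z)
          \<bullet>\<^bsub>C\<^esub> (amap F (asc B ?X ?Y ?Z) \<bullet>\<^bsub>C\<^esub> ?f (?X \<otimes>\<^sub>o\<^bsub>B\<^esub> ?Y) ?Z \<bullet>\<^bsub>C\<^esub> (?f ?X ?Y \<otimes>\<^sub>a\<^bsub>C\<^esub> ?idZ))"
      by (simp add: F.amap_cmp_arr)
    also have "\<dots> = amap F (?g X (Y \<otimes>\<^sub>o\<^bsub>A\<^esub> Z))
          \<bullet>\<^bsub>C\<^esub> (amap F (ident B ?X \<otimes>\<^sub>a\<^bsub>B\<^esub> ?g Y Z) \<bullet>\<^bsub>C\<^esub> ?f ?X (?Y \<otimes>\<^sub>o\<^bsub>B\<^esub> ?Z))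
          \<bullet>\<^bsub>C\<^esub> (?idX \<otimes>\<^sub>a\<^bsub>C\<^esub> ?f ?Y ?Z) \<bullet>\<^bsub>C\<^esub> asc C (omap F ?X) (omap F ?Y) (omap F ?Z)"
      by (simp add: F.coherence_asc)
    also have "\<dots> = (amap F (?g X (Y \<otimes>\<^sub>o\<^bsub>A\<^esub> Z)) \<bullet>\<^bsub>C\<^esub> ?f ?X (omap G (Y \<otimes>\<^sub>o\<^bsub>A\<^esub> Z)))
          \<bullet>\<^bsub>C\<^esub> (?idX \<otimes>\<^sub>a\<^bsub>C\<^esub> (amap F (?g Y Z) \<bullet>\<^bsub>C\<^esub> ?f ?Y ?Z))
          \<bullet>\<^bsub>C\<^esub> asc C (omap F ?X) (omap F ?Y) (omap F ?Z)"
      unfolding natR[symmetric] splitR by simp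
    finally show "amap (comp_monfunc A C F G) (asc A X Y Z)
        \<bullet>\<^bsub>C\<^esub> gam (comp_monfunc A C F G) (X \<otimes>\<^sub>o\<^bsub>A\<^esub> Y, Z)
        \<bullet>\<^bsub>C\<^esub> (gam (comp_monfunc A C F G) (X, Y) \<otimes>\<^sub>a\<^bsub>C\<^esub> ident C (omap (comp_monfunc A C F G) Z))
      = gam (comp_monfunc A C F G) (X, Y \<otimes>\<^sub>o\<^bsub>A\<^esub> Z)
        \<bullet>\<^bsub>C\<^esub> (ident C (omap (comp_monfunc A C F G) X) \<otimes>\<^sub>a\<^bsub>C\<^esub> gam (comp_monfunc A C F G) (Y, Z))
        \<bullet>\<^bsub>C\<^esub> asc C (omap (comp_monfunc A C F G) X) (omap (comp_monfunc A C F G) Y)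
            (omap (comp_monfunc A C F G) Z)"
      by simp
  next
    fix X assume [simp]: "X \<in> Obj A"
    let ?X = "omap G X" let ?id = "ident C (omap F ?X)"
    have split: "(amap F (phi G) \<bullet>\<^bsub>C\<^esub> phi F) \<otimes>\<^sub>a\<^bsub>C\<^esub> ?id
        = (amap F (phi G) \<otimes>\<^sub>a\<^bsub>C\<^esub> amap F (ident B ?X)) \<bullet>\<^bsub>C\<^esub> (phi F \<otimes>\<^sub>a\<^bsub>C\<^esub> ?id)"
      by (simp add: F.B.tensA_cmp)
    have nat: "gam F (omap G (munit A), ?X) \<bullet>\<^bsub>C\<^esub> (amap F (phi G) \<otimes>\<^sub>a\<^bsub>C\<^esub> amap F (ident B ?X))
        = amap F (phi G \<otimes>\<^sub>a\<^bsub>B\<^esub> ident B ?X) \<bullet>\<^bsub>C\<^esub> gam F (munit B, ?X)"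
      by (rule F.gam_natural_arr) auto
    have "amap F (amap G (lun A X)) \<bullet>\<^bsub>C\<^esub> (amap F (gam G (munit A, X))
          \<bullet>\<^bsub>C\<^esub> gam F (omap G (munit A), ?X)) \<bullet>\<^bsub>C\<^esub> ((amap F (phi G) \<bullet>\<^bsub>C\<^esub> phi F) \<otimes>\<^sub>a\<^bsub>C\<^esub> ?id)
        = amap F (amap G (lun A X)) \<bullet>\<^bsub>C\<^esub> amap F (gam G (munit A, X))
          \<bullet>\<^bsub>C\<^esub> (gam F (omap G (munit A), ?X) \<bullet>\<^bsub>C\<^esub> (amap F (phi G) \<otimes>\<^sub>a\<^bsub>C\<^esub> amap F (ident B ?X)))
          \<bullet>\<^bsub>C\<^esub> (phi F \<otimes>\<^sub>a\<^bsub>C\<^esub> ?id)"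
      unfolding split by simp
    also have "\<dots> = amap F (amap G (lun A X) \<bullet>\<^bsub>B\<^esub> gam G (munit A, X)
          \<bullet>\<^bsub>B\<^esub> (phi G \<otimes>\<^sub>a\<^bsub>B\<^esub> ident B ?X)) \<bullet>\<^bsub>C\<^esub> gam F (munit B, ?X) \<bullet>\<^bsub>C\<^esub> (phi F \<otimes>\<^sub>a\<^bsub>C\<^esub> ?id)"
      unfolding nat by (simp add: F.amap_cmp_arr)
    also have "\<dots> = lun C (omap F ?X)"
      by (simp add: G.coherence_lun F.coherence_lun)
    finally show "amap (comp_monfunc A C F G) (lun A X)
        \<bullet>\<^bsub>C\<^esub> gam (comp_monfunc A C F G) (munit A, X)
        \<bullet>\<^bsub>C\<^esub> (phi (comp_monfunc A C F G) \<otimes>\<^sub>a\<^bsub>C\<^esub> ident C (omap (comp_monfunc A C F G) X))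
      = lun C (omap (comp_monfunc A C F G) X)"
      by simp
    have split: "?id \<otimes>\<^sub>a\<^bsub>C\<^esub> (amap F (phi G) \<bullet>\<^bsub>C\<^esub> phi F)
        = (amap F (ident B ?X) \<otimes>\<^sub>a\<^bsub>C\<^esub> amap F (phi G)) \<bullet>\<^bsub>C\<^esub> (?id \<otimes>\<^sub>a\<^bsub>C\<^esub> phi F)"
      by (simp add: F.B.tensA_cmp)
    have nat: "gam F (?X, omap G (munit A)) \<bullet>\<^bsub>C\<^esub> (amap F (ident B ?X) \<otimes>\<^sub>a\<^bsub>C\<^esub> amap F (phi G))
        = amap F (ident B ?X \<otimes>\<^sub>a\<^bsub>B\<^esub> phi G) \<bullet>\<^bsub>C\<^esub> gam F (?X, munit B)"
      by (rule F.gam_natural_arr) auto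
    have "amap F (amap G (run A X)) \<bullet>\<^bsub>C\<^esub> (amap F (gam G (X, munit A))
          \<bullet>\<^bsub>C\<^esub> gam F (?X, omap G (munit A))) \<bullet>\<^bsub>C\<^esub> (?id \<otimes>\<^sub>a\<^bsub>C\<^esub> (amap F (phi G) \<bullet>\<^bsub>C\<^esub> phi F))
        = amap F (amap G (run A X)) \<bullet>\<^bsub>C\<^esub> amap F (gam G (X, munit A))
          \<bullet>\<^bsub>C\<^esub> (gam F (?X, omap G (munit A)) \<bullet>\<^bsub>C\<^esub> (amap F (ident B ?X) \<otimes>\<^sub>a\<^bsub>C\<^esub> amap F (phi G)))
          \<bullet>\<^bsub>C\<^esub> (?id \<otimes>\<^sub>a\<^bsub>C\<^esub> phi F)"
      unfolding split by simp
    also have "\<dots> = amap F (amap G (run A X) \<bullet>\<^bsub>B\<^esub> gam G (X, munit A)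
          \<bullet>\<^bsub>B\<^esub> (ident B ?X \<otimes>\<^sub>a\<^bsub>B\<^esub> phi G)) \<bullet>\<^bsub>C\<^esub> gam F (?X, munit B) \<bullet>\<^bsub>C\<^esub> (?id \<otimes>\<^sub>a\<^bsub>C\<^esub> phi F)"
      unfolding nat by (simp add: F.amap_cmp_arr)
    also have "\<dots> = run C (omap F ?X)"
      by (simp add: G.coherence_run F.coherence_run)
    finally show "amap (comp_monfunc A C F G) (run A X)
        \<bullet>\<^bsub>C\<^esub> gam (comp_monfunc A C F G) (X, munit A)
        \<bullet>\<^bsub>C\<^esub> (ident C (omap (comp_monfunc A C F G) X) \<otimes>\<^sub>a\<^bsub>C\<^esub> phi (comp_monfunc A C F G))
      = run C (omap (comp_monfunc A C F G) X)"
      by simp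
  qed
qed

lemma braided_monoidal_functor_comp:
  fixes A B C :: "('o, 'a, 'k) brmoncat"
  assumes "braided_monoidal_functor B C F" "braided_monoidal_functor A B G"
  shows "braided_monoidal_functor A C (comp_monfunc A C F G)"
proof -
  interpret F: braided_monoidal_functor B C F by fact
  interpret G: braided_monoidal_functor A B G by fact
  interpret monoidal_functor A C "comp_monfunc A C F G"
    by (rule monoidal_functor_comp) unfold_locales
  show ?thesis
  proof unfold_locales
    fix X Y assume [simp]: "X \<in> Obj A" "Y \<in> Obj A"
    have "amap F (amap G (brd A X Y)) \<bullet>\<^bsub>C\<^esub> amap F (gam G (X, Y)) \<bullet>\<^bsub>C\<^esub> gam F (omap G X, omap G Y)
        = amap F (amap G (brd A X Y) \<bullet>\<^bsub>B\<^esub> gam G (X, Y)) \<bullet>\<^bsub>C\<^esub> gam F (omap G X, omap G Y)"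
      by (simp add: F.amap_cmp_arr)
    also have "\<dots> = amap F (gam G (Y, X)) \<bullet>\<^bsub>C\<^esub> gam F (omap G Y, omap G X)
        \<bullet>\<^bsub>C\<^esub> brd C (omap F (omap G X)) (omap F (omap G Y))"
      by (simp add: G.gam_brd F.gam_brd F.amap_cmp_arr)
    finally show "amap (comp_monfunc A C F G) (brd A X Y) \<bullet>\<^bsub>C\<^esub> gam (comp_monfunc A C F G) (X, Y)
        = gam (comp_monfunc A C F G) (Y, X)
          \<bullet>\<^bsub>C\<^esub> brd C (omap (comp_monfunc A C F G) X) (omap (comp_monfunc A C F G) Y)"
      by simp
  qed
qed

lemma braided_functorsD:
  assumes "F \<in> braided_functors A B"
  shows "braided_monoidal_functor A B F" "monoidal_functor A B F" "cat_functor A B F"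
proof -
  show "braided_monoidal_functor A B F"
    using assms by (simp add: braided_functors_def)
  then interpret braided_monoidal_functor A B F .
  show "monoidal_functor A B F" "cat_functor A B F"
    by unfold_locales
qed

lemma id_monfunc_braided:
  "braided_monoidal_category A \<Longrightarrow> id_monfunc A \<in> braided_functors A A"
  by (simp add: braided_functors_def braided_monoidal_functor_id)
    (auto simp: id_monfunc_def extensional_def)

lemma comp_monfunc_braided:
  "F \<in> braided_functors B C \<Longrightarrow> G \<in> braided_functors A B
    \<Longrightarrow> comp_monfunc A C F G \<in> braided_functors A C"
  by (simp add: braided_functors_def braided_monoidal_functor_comp[of B C F A G])
    (auto simp: comp_monfunc_def extensional_def)

text \<open>
  Equality of 1-arrows can be tested on the carriers because their data is extensional. This, and
  its analogue for 2-arrows below, is what makes the strict laws true equations.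
\<close>

lemma braided_functor_eqI:
  assumes "F \<in> braided_functors A B" "G \<in> braided_functors A B"
    "\<And>X. X \<in> Obj A \<Longrightarrow> omap F X = omap G X" "\<And>f. f \<in> Arr A \<Longrightarrow> amap F f = amap G f"
    "\<And>X Y. X \<in> Obj A \<Longrightarrow> Y \<in> Obj A \<Longrightarrow> gam F (X, Y) = gam G (X, Y)" "phi F = phi G"
  shows "F = G"
proof (rule monfunc.equality)
  show "omap F = omap G" "amap F = amap G" "gam F = gam G"
    using assms by (auto simp: braided_functors_def intro!: extensionalityI)
qed (use assms in auto)

text \<open>
  Only the structure maps need an argument: with \<open>f\<close>, \<open>g\<close>, \<open>h\<close> for the maps \<open>gam\<close> of
  \<open>F\<close>, \<open>G\<close>, \<open>H\<close>, they are \<open>H (G f) \<bullet> (H g \<bullet> h)\<close> and \<open>H (G f \<bullet> g) \<bullet> h\<close>, which agree since \<open>H\<close>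
  preserves composition;
  likewise for \<open>phi\<close>.
\<close>

lemma comp_monfunc_assoc:
  assumes "F \<in> braided_functors A B" "G \<in> braided_functors B C" "H \<in> braided_functors C D"
  shows "comp_monfunc A D (comp_monfunc B D H G) F = comp_monfunc A D H (comp_monfunc A C G F)"
proof -
  interpret F: monoidal_functor A B F using assms(1) by (rule braided_functorsD)
  interpret G: monoidal_functor B C G using assms(2) by (rule braided_functorsD)
  interpret H: monoidal_functor C D H using assms(3) by (rule braided_functorsD)
  show ?thesis
    by (rule braided_functor_eqI[of _ A D]) (use assms in
      \<open>auto intro!: comp_monfunc_braided simp: H.amap_cmp_arr\<close>)
qed

lemma comp_monfunc_id_left:
  assumes "F \<in> braided_functors A B"
  shows "comp_monfunc A B (id_monfunc B) F = F"
proof -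
  interpret F: braided_monoidal_functor A B F using assms by (rule braided_functorsD)
  show ?thesis
    by (rule braided_functor_eqI[of _ A B]) (use assms in
      \<open>auto intro!: comp_monfunc_braided id_monfunc_braided F.B.braided_monoidal_category_axioms\<close>)
qed

lemma comp_monfunc_id_right:
  assumes "F \<in> braided_functors A B"
  shows "comp_monfunc A B F (id_monfunc A) = F"
proof -
  interpret F: braided_monoidal_functor A B F using assms by (rule braided_functorsD)
  show ?thesis
    by (rule braided_functor_eqI[of _ A B]) (use assms in
      \<open>auto intro!: comp_monfunc_braided id_monfunc_braided F.A.braided_monoidal_category_axioms\<close>)
qed

section \<open>Vertical and horizontal composites of monoidal isomorphisms\<close>

lemma monoidal_nat_iso_ident:
  assumes "monoidal_functor A B F"
  shows "monoidal_nat_iso A B F F (\<lambda>X\<in>Obj A. ident B (omap F X))"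
proof -
  interpret F: monoidal_functor A B F by fact
  show ?thesis
  proof unfold_locales
    fix f X Y assume "f \<in> homset A X Y"
    moreover from this have "X \<in> Obj A" "Y \<in> Obj A"
      using F.A.src_obj[of f] F.A.tgt_obj[of f] by (auto simp: homset_def)
    ultimately show "(\<lambda>X\<in>Obj A. ident B (omap F X)) Y \<bullet>\<^bsub>B\<^esub> amap F f
        = amap F f \<bullet>\<^bsub>B\<^esub> (\<lambda>X\<in>Obj A. ident B (omap F X)) X"
      by (simp add: homset_def)
  qed (auto simp: homset_def F.B.ident_isos)
qed

lemma monoidal_nat_iso_vcomp:
  assumes "monoidal_nat_iso A B G H \<theta>" "monoidal_nat_iso A B F G \<eta>"
  shows "monoidal_nat_iso A B F H (\<lambda>X\<in>Obj A. \<theta> X \<bullet>\<^bsub>B\<^esub> \<eta> X)"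
proof -
  interpret \<theta>: monoidal_nat_iso A B G H \<theta> by fact
  interpret \<eta>: monoidal_nat_iso A B F G \<eta> by fact
  show ?thesis
  proof unfold_locales
    fix X assume "X \<in> Obj A"
    then show "(\<lambda>X\<in>Obj A. \<theta> X \<bullet>\<^bsub>B\<^esub> \<eta> X) X \<in> homset B (omap F X) (omap H X)"
      by (simp add: homset_def)
  next
    fix f X Y assume "f \<in> homset A X Y"
    then have [simp]: "f \<in> Arr A" "src A f = X" "tgt A f = Y"
      by (auto simp: homset_def)
    have [simp]: "X \<in> Obj A" "Y \<in> Obj A"
      using \<theta>.F.A.src_obj[of f] \<theta>.F.A.tgt_obj[of f] by auto
    have "(\<theta> Y \<bullet>\<^bsub>B\<^esub> \<eta> Y) \<bullet>\<^bsub>B\<^esub> amap F f = (\<theta> Y \<bullet>\<^bsub>B\<^esub> amap G f) \<bullet>\<^bsub>B\<^esub> \<eta> X"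
      by (simp add: \<eta>.naturality_arr)
    also have "\<dots> = amap H f \<bullet>\<^bsub>B\<^esub> \<theta> X \<bullet>\<^bsub>B\<^esub> \<eta> X"
      unfolding \<theta>.naturality_arr[of f X Y, simplified] by simp
    finally show "(\<lambda>X\<in>Obj A. \<theta> X \<bullet>\<^bsub>B\<^esub> \<eta> X) Y \<bullet>\<^bsub>B\<^esub> amap F f
        = amap H f \<bullet>\<^bsub>B\<^esub> (\<lambda>X\<in>Obj A. \<theta> X \<bullet>\<^bsub>B\<^esub> \<eta> X) X"
      by simp
  next
    fix X Y assume [simp]: "X \<in> Obj A" "Y \<in> Obj A"
    let ?XY = "X \<otimes>\<^sub>o\<^bsub>A\<^esub> Y"
    have "(\<theta> ?XY \<bullet>\<^bsub>B\<^esub> \<eta> ?XY) \<bullet>\<^bsub>B\<^esub> gam F (X, Y) = (\<theta> ?XY \<bullet>\<^bsub>B\<^esub> gam G (X, Y)) \<bullet>\<^bsub>B\<^esub> (\<eta> X \<otimes>\<^sub>a\<^bsub>B\<^esub> \<eta> Y)"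
      by (simp add: \<eta>.component_tensor)
    also have "\<dots> = gam H (X, Y) \<bullet>\<^bsub>B\<^esub> ((\<theta> X \<bullet>\<^bsub>B\<^esub> \<eta> X) \<otimes>\<^sub>a\<^bsub>B\<^esub> (\<theta> Y \<bullet>\<^bsub>B\<^esub> \<eta> Y))"
      unfolding \<theta>.component_tensor[of X Y, simplified] by (simp add: \<theta>.F.B.tensA_cmp)
    finally show "(\<lambda>X\<in>Obj A. \<theta> X \<bullet>\<^bsub>B\<^esub> \<eta> X) ?XY \<bullet>\<^bsub>B\<^esub> gam F (X, Y) = gam H (X, Y)
        \<bullet>\<^bsub>B\<^esub> ((\<lambda>X\<in>Obj A. \<theta> X \<bullet>\<^bsub>B\<^esub> \<eta> X) X \<otimes>\<^sub>a\<^bsub>B\<^esub> (\<lambda>X\<in>Obj A. \<theta> X \<bullet>\<^bsub>B\<^esub> \<eta> X) Y)"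
      by simp
  next
    show "(\<lambda>X\<in>Obj A. \<theta> X \<bullet>\<^bsub>B\<^esub> \<eta> X) (munit A) \<bullet>\<^bsub>B\<^esub> phi F = phi H"
      by (simp add: \<eta>.component_unit \<theta>.component_unit)
  next
    fix X assume "X \<in> Obj A"
    then show "(\<lambda>X\<in>Obj A. \<theta> X \<bullet>\<^bsub>B\<^esub> \<eta> X) X \<in> isos B (omap F X) (omap H X)"
      by (auto intro: \<theta>.F.B.cmp_isos \<theta>.component_iso \<eta>.component_iso)
  qed
qed

text \<open>
  Each condition is the corresponding one for \<open>\<eta>\<close>, taken under \<open>F\<close>, pasted to the one for \<open>\<theta>\<close>.
  They are joined by the naturality of \<open>\<theta>\<close> at the arrow on which the condition for \<open>\<eta>\<close> ends: \<open>G' f\<close>,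
  the map \<open>gam G'\<close> or the map \<open>phi G'\<close>. The tensor condition also uses that \<open>gam F\<close> is natural at
  \<open>\<eta> X \<otimes> \<eta> Y\<close>.
\<close>

lemma monoidal_nat_iso_hcomp:
  fixes A B C :: "('o, 'a, 'k) brmoncat"
  assumes "monoidal_nat_iso B C F F' \<theta>" "monoidal_nat_iso A B G G' \<eta>"
  shows "monoidal_nat_iso A C (comp_monfunc A C F G) (comp_monfunc A C F' G')
    (\<lambda>X\<in>Obj A. \<theta> (omap G' X) \<bullet>\<^bsub>C\<^esub> amap F (\<eta> X))"
proof -
  interpret \<theta>: monoidal_nat_iso B C F F' \<theta> by fact
  interpret \<eta>: monoidal_nat_iso A B G G' \<eta> by fact
  interpret FG: monoidal_functor A C "comp_monfunc A C F G"
    by (rule monoidal_functor_comp) unfold_locales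
  interpret FG': monoidal_functor A C "comp_monfunc A C F' G'"
    by (rule monoidal_functor_comp) unfold_locales
  show ?thesis
  proof unfold_locales
    fix X assume "X \<in> Obj A"
    then show "(\<lambda>X\<in>Obj A. \<theta> (omap G' X) \<bullet>\<^bsub>C\<^esub> amap F (\<eta> X)) X
        \<in> homset C (omap (comp_monfunc A C F G) X) (omap (comp_monfunc A C F' G') X)"
      by (simp add: homset_def)
  next
    fix f X Y assume "f \<in> homset A X Y"
    then have [simp]: "f \<in> Arr A" "src A f = X" "tgt A f = Y"
      by (auto simp: homset_def)
    have [simp]: "X \<in> Obj A" "Y \<in> Obj A"
      using \<eta>.F.A.src_obj[of f] \<eta>.F.A.tgt_obj[of f] by auto
    have "(\<theta> (omap G' Y) \<bullet>\<^bsub>C\<^esub> amap F (\<eta> Y)) \<bullet>\<^bsub>C\<^esub> amap F (amap G f)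
        = \<theta> (omap G' Y) \<bullet>\<^bsub>C\<^esub> amap F (\<eta> Y \<bullet>\<^bsub>B\<^esub> amap G f)"
      by (simp add: \<theta>.F.amap_cmp_arr)
    also have "\<dots> = (\<theta> (omap G' Y) \<bullet>\<^bsub>C\<^esub> amap F (amap G' f)) \<bullet>\<^bsub>C\<^esub> amap F (\<eta> X)"
      by (simp add: \<eta>.naturality_arr[of f X Y] \<theta>.F.amap_cmp_arr)
    also have "\<theta> (omap G' Y) \<bullet>\<^bsub>C\<^esub> amap F (amap G' f) = amap F' (amap G' f) \<bullet>\<^bsub>C\<^esub> \<theta> (omap G' X)"
      by (rule \<theta>.naturality_arr) auto
    finally show "(\<lambda>X\<in>Obj A. \<theta> (omap G' X) \<bullet>\<^bsub>C\<^esub> amap F (\<eta> X)) Y \<bullet>\<^bsub>C\<^esub> amap (comp_monfunc A C F G) f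
        = amap (comp_monfunc A C F' G') f \<bullet>\<^bsub>C\<^esub> (\<lambda>X\<in>Obj A. \<theta> (omap G' X) \<bullet>\<^bsub>C\<^esub> amap F (\<eta> X)) X"
      by simp
  next
    fix X Y assume [simp]: "X \<in> Obj A" "Y \<in> Obj A"
    let ?XY = "X \<otimes>\<^sub>o\<^bsub>A\<^esub> Y" and ?GX = "omap G X" and ?GY = "omap G Y"
    let ?G'X = "omap G' X" and ?G'Y = "omap G' Y"
    have "(\<theta> (omap G' ?XY) \<bullet>\<^bsub>C\<^esub> amap F (\<eta> ?XY)) \<bullet>\<^bsub>C\<^esub> amap F (gam G (X, Y)) \<bullet>\<^bsub>C\<^esub> gam F (?GX, ?GY)
        = \<theta> (omap G' ?XY) \<bullet>\<^bsub>C\<^esub> amap F (\<eta> ?XY \<bullet>\<^bsub>B\<^esub> gam G (X, Y)) \<bullet>\<^bsub>C\<^esub> gam F (?GX, ?GY)"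
      by (simp add: \<theta>.F.amap_cmp_arr)
    also have "\<dots> = (\<theta> (omap G' ?XY) \<bullet>\<^bsub>C\<^esub> amap F (gam G' (X, Y)))
        \<bullet>\<^bsub>C\<^esub> amap F (\<eta> X \<otimes>\<^sub>a\<^bsub>B\<^esub> \<eta> Y) \<bullet>\<^bsub>C\<^esub> gam F (?GX, ?GY)"
      by (simp add: \<eta>.component_tensor \<theta>.F.amap_cmp_arr)
    also have "\<theta> (omap G' ?XY) \<bullet>\<^bsub>C\<^esub> amap F (gam G' (X, Y))
        = amap F' (gam G' (X, Y)) \<bullet>\<^bsub>C\<^esub> \<theta> (?G'X \<otimes>\<^sub>o\<^bsub>B\<^esub> ?G'Y)"
      by (rule \<theta>.naturality_arr) auto
    also have "amap F (\<eta> X \<otimes>\<^sub>a\<^bsub>B\<^esub> \<eta> Y) \<bullet>\<^bsub>C\<^esub> gam F (?GX, ?GY)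
        = gam F (?G'X, ?G'Y) \<bullet>\<^bsub>C\<^esub> (amap F (\<eta> X) \<otimes>\<^sub>a\<^bsub>C\<^esub> amap F (\<eta> Y))"
      by (rule \<theta>.F.gam_natural_arr[symmetric]) auto
    also have "(amap F' (gam G' (X, Y)) \<bullet>\<^bsub>C\<^esub> \<theta> (?G'X \<otimes>\<^sub>o\<^bsub>B\<^esub> ?G'Y))
          \<bullet>\<^bsub>C\<^esub> gam F (?G'X, ?G'Y) \<bullet>\<^bsub>C\<^esub> (amap F (\<eta> X) \<otimes>\<^sub>a\<^bsub>C\<^esub> amap F (\<eta> Y))
        = amap F' (gam G' (X, Y)) \<bullet>\<^bsub>C\<^esub> (\<theta> (?G'X \<otimes>\<^sub>o\<^bsub>B\<^esub> ?G'Y) \<bullet>\<^bsub>C\<^esub> gam F (?G'X, ?G'Y))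
          \<bullet>\<^bsub>C\<^esub> (amap F (\<eta> X) \<otimes>\<^sub>a\<^bsub>C\<^esub> amap F (\<eta> Y))"
      by simp
    also have "\<dots> = (amap F' (gam G' (X, Y)) \<bullet>\<^bsub>C\<^esub> gam F' (?G'X, ?G'Y))
        \<bullet>\<^bsub>C\<^esub> ((\<theta> ?G'X \<bullet>\<^bsub>C\<^esub> amap F (\<eta> X)) \<otimes>\<^sub>a\<^bsub>C\<^esub> (\<theta> ?G'Y \<bullet>\<^bsub>C\<^esub> amap F (\<eta> Y)))"
      by (simp add: \<theta>.component_tensor \<theta>.F.B.tensA_cmp)
    finally show "(\<lambda>X\<in>Obj A. \<theta> (omap G' X) \<bullet>\<^bsub>C\<^esub> amap F (\<eta> X)) ?XY
          \<bullet>\<^bsub>C\<^esub> gam (comp_monfunc A C F G) (X, Y)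
        = gam (comp_monfunc A C F' G') (X, Y)
          \<bullet>\<^bsub>C\<^esub> ((\<lambda>X\<in>Obj A. \<theta> (omap G' X) \<bullet>\<^bsub>C\<^esub> amap F (\<eta> X)) X
            \<otimes>\<^sub>a\<^bsub>C\<^esub> (\<lambda>X\<in>Obj A. \<theta> (omap G' X) \<bullet>\<^bsub>C\<^esub> amap F (\<eta> X)) Y)"
      by simp
  next
    let ?I = "munit A"
    have "(\<theta> (omap G' ?I) \<bullet>\<^bsub>C\<^esub> amap F (\<eta> ?I)) \<bullet>\<^bsub>C\<^esub> amap F (phi G) \<bullet>\<^bsub>C\<^esub> phi F
        = \<theta> (omap G' ?I) \<bullet>\<^bsub>C\<^esub> amap F (\<eta> ?I \<bullet>\<^bsub>B\<^esub> phi G) \<bullet>\<^bsub>C\<^esub> phi F"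
      by (simp add: \<theta>.F.amap_cmp_arr)
    also have "\<dots> = (\<theta> (omap G' ?I) \<bullet>\<^bsub>C\<^esub> amap F (phi G')) \<bullet>\<^bsub>C\<^esub> phi F"
      by (simp add: \<eta>.component_unit)
    also have "\<theta> (omap G' ?I) \<bullet>\<^bsub>C\<^esub> amap F (phi G') = amap F' (phi G') \<bullet>\<^bsub>C\<^esub> \<theta> (munit B)"
      by (rule \<theta>.naturality_arr) auto
    also have "(amap F' (phi G') \<bullet>\<^bsub>C\<^esub> \<theta> (munit B)) \<bullet>\<^bsub>C\<^esub> phi F = amap F' (phi G') \<bullet>\<^bsub>C\<^esub> phi F'"
      by (simp add: \<theta>.component_unit)
    finally show "(\<lambda>X\<in>Obj A. \<theta> (omap G' X) \<bullet>\<^bsub>C\<^esub> amap F (\<eta> X)) (munit A)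
          \<bullet>\<^bsub>C\<^esub> phi (comp_monfunc A C F G) = phi (comp_monfunc A C F' G')"
      by simp
  next
    fix X assume "X \<in> Obj A"
    then show "(\<lambda>X\<in>Obj A. \<theta> (omap G' X) \<bullet>\<^bsub>C\<^esub> amap F (\<eta> X)) X
        \<in> isos C (omap (comp_monfunc A C F G) X) (omap (comp_monfunc A C F' G') X)"
      by (auto intro!: \<theta>.F.B.cmp_isos \<theta>.component_iso \<theta>.F.amap_isos \<eta>.component_iso)
  qed
qed

section \<open>The hom-categories and the composition functor\<close>

lemma MCT_hom_simps [simp]:
  "Obj (MCT_hom A B) = braided_functors A B"
  "src (MCT_hom A B) = nsrc"
  "tgt (MCT_hom A B) = ntgt"
  "nsrc (ident (MCT_hom A B) F) = F"
  "ntgt (ident (MCT_hom A B) F) = F"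
  "X \<in> Obj A \<Longrightarrow> ncomp (ident (MCT_hom A B) F) X = ident B (omap F X)"
  "nsrc (\<theta> \<bullet>\<^bsub>MCT_hom A B\<^esub> \<eta>) = nsrc \<eta>"
  "ntgt (\<theta> \<bullet>\<^bsub>MCT_hom A B\<^esub> \<eta>) = ntgt \<theta>"
  "X \<in> Obj A \<Longrightarrow> ncomp (\<theta> \<bullet>\<^bsub>MCT_hom A B\<^esub> \<eta>) X = ncomp \<theta> X \<bullet>\<^bsub>B\<^esub> ncomp \<eta> X"
  by (simp_all add: MCT_hom_def)

lemma MCT_hcomp_simps [simp]:
  "omap (MCT_hcomp A C) (F, G) = comp_monfunc A C F G"
  "nsrc (amap (MCT_hcomp A C) (\<theta>, \<eta>)) = comp_monfunc A C (nsrc \<theta>) (nsrc \<eta>)"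
  "ntgt (amap (MCT_hcomp A C) (\<theta>, \<eta>)) = comp_monfunc A C (ntgt \<theta>) (ntgt \<eta>)"
  "X \<in> Obj A \<Longrightarrow> ncomp (amap (MCT_hcomp A C) (\<theta>, \<eta>)) X
    = ncomp \<theta> (omap (ntgt \<eta>) X) \<bullet>\<^bsub>C\<^esub> amap (nsrc \<theta>) (ncomp \<eta> X)"
  by (simp_all add: MCT_hcomp_def)

lemma MCT_homD:
  assumes "\<theta> \<in> Arr (MCT_hom A B)"
  shows "nsrc \<theta> \<in> braided_functors A B" "ntgt \<theta> \<in> braided_functors A B"
    "monoidal_nat_iso A B (nsrc \<theta>) (ntgt \<theta>) (ncomp \<theta>)"
  using assms by (auto simp: MCT_hom_def)

lemma MCT_hom_eqI:
  assumes "\<theta> \<in> Arr (MCT_hom A B)" "\<eta> \<in> Arr (MCT_hom A B)"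
    "nsrc \<theta> = nsrc \<eta>" "ntgt \<theta> = ntgt \<eta>" "\<And>X. X \<in> Obj A \<Longrightarrow> ncomp \<theta> X = ncomp \<eta> X"
  shows "\<theta> = \<eta>"
proof (rule ntrans.equality)
  show "ncomp \<theta> = ncomp \<eta>"
    using assms by (auto simp: MCT_hom_def intro!: extensionalityI)
qed (use assms in auto)

lemma MCT_ident_arr:
  "F \<in> braided_functors A B \<Longrightarrow> ident (MCT_hom A B) F \<in> Arr (MCT_hom A B)"
  using monoidal_nat_iso_ident[OF braided_functorsD(2)] by (auto simp: MCT_hom_def)

lemma MCT_vcomp_arr:
  "\<theta> \<in> Arr (MCT_hom A B) \<Longrightarrow> \<eta> \<in> Arr (MCT_hom A B) \<Longrightarrow> nsrc \<theta> = ntgt \<eta>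
    \<Longrightarrow> \<theta> \<bullet>\<^bsub>MCT_hom A B\<^esub> \<eta> \<in> Arr (MCT_hom A B)"
  by (auto simp: MCT_hom_def intro!: monoidal_nat_iso_vcomp)

lemma MCT_hcomp_arr:
  "\<theta> \<in> Arr (MCT_hom B C) \<Longrightarrow> \<eta> \<in> Arr (MCT_hom A B)
    \<Longrightarrow> amap (MCT_hcomp A C) (\<theta>, \<eta>) \<in> Arr (MCT_hom A C)"
  by (auto simp: MCT_hom_def MCT_hcomp_def intro!: monoidal_nat_iso_hcomp comp_monfunc_braided)

lemma category_MCT_hom: "category (MCT_hom A B)"
proof
  fix \<theta> F G assume \<theta>: "\<theta> \<in> homset (MCT_hom A B) F G"
  then have arr: "\<theta> \<in> Arr (MCT_hom A B)"
    by (simp add: homset_def)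
  interpret monoidal_nat_iso A B "nsrc \<theta>" "ntgt \<theta>" "ncomp \<theta>"
    using MCT_homD(3)[OF arr] .
  show "ident (MCT_hom A B) G \<bullet>\<^bsub>MCT_hom A B\<^esub> \<theta> = \<theta>" "\<theta> \<bullet>\<^bsub>MCT_hom A B\<^esub> ident (MCT_hom A B) F = \<theta>"
    by (rule MCT_hom_eqI[of _ A B]; use \<theta> in
      \<open>auto simp: homset_def MCT_homD intro!: MCT_vcomp_arr MCT_ident_arr\<close>)+
next
  fix \<alpha> \<beta> \<gamma> F G H L
  assume hom: "\<alpha> \<in> homset (MCT_hom A B) F G" "\<beta> \<in> homset (MCT_hom A B) G H"
    "\<gamma> \<in> homset (MCT_hom A B) H L"
  then have arr: "\<alpha> \<in> Arr (MCT_hom A B)" "\<beta> \<in> Arr (MCT_hom A B)" "\<gamma> \<in> Arr (MCT_hom A B)"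
    by (auto simp: homset_def)
  have [simp]: "nsrc \<alpha> = F" "ntgt \<alpha> = G" "nsrc \<beta> = G" "ntgt \<beta> = H" "nsrc \<gamma> = H" "ntgt \<gamma> = L"
    using hom by (auto simp: homset_def)
  interpret \<alpha>: monoidal_nat_iso A B F G "ncomp \<alpha>"
    using MCT_homD(3)[OF arr(1)] by simp
  interpret \<beta>: monoidal_nat_iso A B G H "ncomp \<beta>"
    using MCT_homD(3)[OF arr(2)] by simp
  interpret \<gamma>: monoidal_nat_iso A B H L "ncomp \<gamma>"
    using MCT_homD(3)[OF arr(3)] by simp
  show "(\<gamma> \<bullet>\<^bsub>MCT_hom A B\<^esub> \<beta>) \<bullet>\<^bsub>MCT_hom A B\<^esub> \<alpha> = \<gamma> \<bullet>\<^bsub>MCT_hom A B\<^esub> \<beta> \<bullet>\<^bsub>MCT_hom A B\<^esub> \<alpha>"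
    by (rule MCT_hom_eqI[of _ A B]) (use arr in \<open>auto intro!: MCT_vcomp_arr\<close>)
qed (auto simp: homset_def MCT_homD intro!: MCT_ident_arr MCT_vcomp_arr)

lemma category_prod_cat:
  assumes "category C" "category D"
  shows "category (prod_cat C D)"
proof -
  interpret C: category C by fact
  interpret D: category D by fact
  show ?thesis
    by unfold_locales (auto simp: prod_cat_def homset_def)
qed

text \<open>
  Preservation of composition is the interchange law. For \<open>\<theta>\<close>, \<open>\<theta>'\<close> and \<open>\<eta>\<close>, \<open>\<eta>'\<close> composed vertically,
  its two sides differ at \<open>X\<close> only in the middle factors, \<open>\<theta>\<close> after \<open>F (\<eta>' X)\<close> against \<open>F' (\<eta>' X)\<close> after
  \<open>\<theta>\<close>, where \<open>\<theta> : F \<Rightarrow> F'\<close>; these agree by naturality of \<open>\<theta>\<close> at \<open>\<eta>' X\<close>.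
\<close>

lemma cat_functor_MCT_hcomp:
  "cat_functor (prod_cat (MCT_hom B C) (MCT_hom A B)) (MCT_hom A C) (MCT_hcomp A C)"
proof -
  interpret P: category "prod_cat (MCT_hom B C) (MCT_hom A B)"
    by (intro category_prod_cat category_MCT_hom)
  interpret M: category "MCT_hom A C"
    by (rule category_MCT_hom)
  show ?thesis
  proof
    fix P assume "P \<in> Obj (prod_cat (MCT_hom B C) (MCT_hom A B))"
    then obtain F G where P: "P = (F, G)" "F \<in> braided_functors B C" "G \<in> braided_functors A B"
      by (auto simp: prod_cat_def)
    interpret F: monoidal_functor B C F using P(2) by (rule braided_functorsD)
    interpret G: monoidal_functor A B G using P(3) by (rule braided_functorsD)
    show "omap (MCT_hcomp A C) P \<in> Obj (MCT_hom A C)"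
      using P by (simp add: comp_monfunc_braided)
    show "amap (MCT_hcomp A C) (ident (prod_cat (MCT_hom B C) (MCT_hom A B)) P)
        = ident (MCT_hom A C) (omap (MCT_hcomp A C) P)"
      by (rule MCT_hom_eqI[of _ A C]) (use P in
        \<open>auto simp: prod_cat_def intro!: MCT_hcomp_arr MCT_ident_arr comp_monfunc_braided\<close>)
  next
    fix p P Q assume "p \<in> homset (prod_cat (MCT_hom B C) (MCT_hom A B)) P Q"
    then show "amap (MCT_hcomp A C) p
        \<in> homset (MCT_hom A C) (omap (MCT_hcomp A C) P) (omap (MCT_hcomp A C) Q)"
      by (cases p) (auto simp: prod_cat_def homset_def intro!: MCT_hcomp_arr)
  next
    fix p q P Q R
    assume hom: "p \<in> homset (prod_cat (MCT_hom B C) (MCT_hom A B)) P Q"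
      "q \<in> homset (prod_cat (MCT_hom B C) (MCT_hom A B)) Q R"
    obtain \<theta> \<eta> \<theta>' \<eta>' where pq: "p = (\<theta>, \<eta>)" "q = (\<theta>', \<eta>')"
      by (cases p, cases q)
    have arr: "\<theta> \<in> Arr (MCT_hom B C)" "\<eta> \<in> Arr (MCT_hom A B)"
        "\<theta>' \<in> Arr (MCT_hom B C)" "\<eta>' \<in> Arr (MCT_hom A B)"
      and [simp]: "nsrc \<theta>' = ntgt \<theta>" "nsrc \<eta>' = ntgt \<eta>"
      using hom pq by (auto simp: prod_cat_def homset_def)
    interpret \<theta>: monoidal_nat_iso B C "nsrc \<theta>" "ntgt \<theta>" "ncomp \<theta>"
      using MCT_homD(3)[OF arr(1)] .
    interpret \<eta>: monoidal_nat_iso A B "nsrc \<eta>" "ntgt \<eta>" "ncomp \<eta>"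
      using MCT_homD(3)[OF arr(2)] .
    interpret \<theta>': monoidal_nat_iso B C "ntgt \<theta>" "ntgt \<theta>'" "ncomp \<theta>'"
      using MCT_homD(3)[OF arr(3)] by simp
    interpret \<eta>': monoidal_nat_iso A B "ntgt \<eta>" "ntgt \<eta>'" "ncomp \<eta>'"
      using MCT_homD(3)[OF arr(4)] by simp
    have "amap (MCT_hcomp A C) (\<theta>' \<bullet>\<^bsub>MCT_hom B C\<^esub> \<theta>, \<eta>' \<bullet>\<^bsub>MCT_hom A B\<^esub> \<eta>)
        = amap (MCT_hcomp A C) (\<theta>', \<eta>') \<bullet>\<^bsub>MCT_hom A C\<^esub> amap (MCT_hcomp A C) (\<theta>, \<eta>)"
    proof (rule MCT_hom_eqI[of _ A C])
      fix X assume [simp]: "X \<in> Obj A"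
      let ?Y = "omap (ntgt \<eta>) X" and ?Z = "omap (ntgt \<eta>') X"
      have "ncomp \<theta> ?Z \<bullet>\<^bsub>C\<^esub> amap (nsrc \<theta>) (ncomp \<eta>' X)
          = amap (ntgt \<theta>) (ncomp \<eta>' X) \<bullet>\<^bsub>C\<^esub> ncomp \<theta> ?Y"
        by (rule \<theta>.naturality_arr) auto
      then have "ncomp \<theta> ?Z \<bullet>\<^bsub>C\<^esub> amap (nsrc \<theta>) (ncomp \<eta>' X) \<bullet>\<^bsub>C\<^esub> amap (nsrc \<theta>) (ncomp \<eta> X)
          = amap (ntgt \<theta>) (ncomp \<eta>' X) \<bullet>\<^bsub>C\<^esub> ncomp \<theta> ?Y \<bullet>\<^bsub>C\<^esub> amap (nsrc \<theta>) (ncomp \<eta> X)"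
        by (rule \<theta>.F.B.cmp_square) auto
      then show "ncomp (amap (MCT_hcomp A C) (\<theta>' \<bullet>\<^bsub>MCT_hom B C\<^esub> \<theta>, \<eta>' \<bullet>\<^bsub>MCT_hom A B\<^esub> \<eta>)) X
          = ncomp (amap (MCT_hcomp A C) (\<theta>', \<eta>') \<bullet>\<^bsub>MCT_hom A C\<^esub> amap (MCT_hcomp A C) (\<theta>, \<eta>)) X"
        by (simp add: \<theta>.F.amap_cmp_arr)
    qed (use arr in \<open>auto intro!: MCT_hcomp_arr MCT_vcomp_arr\<close>)
    then show "amap (MCT_hcomp A C) (q \<bullet>\<^bsub>prod_cat (MCT_hom B C) (MCT_hom A B)\<^esub> p)
        = amap (MCT_hcomp A C) q \<bullet>\<^bsub>MCT_hom A C\<^esub> amap (MCT_hcomp A C) p"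
      by (simp add: pq prod_cat_def)
  qed
qed

lemma MCT_hcomp_ident:
  "F \<in> braided_functors A B \<Longrightarrow> G \<in> braided_functors B C
    \<Longrightarrow> amap (MCT_hcomp A C) (ident (MCT_hom B C) G, ident (MCT_hom A B) F)
      = ident (MCT_hom A C) (comp_monfunc A C G F)"
  using cat_functor.amap_ident[OF cat_functor_MCT_hcomp, of "(G, F)" B C A]
  by (simp add: prod_cat_def)

text \<open>
  The ends of both sides agree by associativity for functors. At \<open>X\<close> the sides differ only in whether
  the source functor of \<open>\<gamma>\<close> is applied before or after composing the components of \<open>\<beta>\<close> and \<open>\<alpha>\<close>.
\<close>

lemma MCT_hcomp_assoc:
  assumes "\<alpha> \<in> Arr (MCT_hom A B)" "\<beta> \<in> Arr (MCT_hom B C)" "\<gamma> \<in> Arr (MCT_hom C D)"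
  shows "amap (MCT_hcomp A D) (amap (MCT_hcomp B D) (\<gamma>, \<beta>), \<alpha>)
    = amap (MCT_hcomp A D) (\<gamma>, amap (MCT_hcomp A C) (\<beta>, \<alpha>))"
proof -
  interpret \<alpha>: monoidal_nat_iso A B "nsrc \<alpha>" "ntgt \<alpha>" "ncomp \<alpha>"
    using MCT_homD(3)[OF assms(1)] .
  interpret \<beta>: monoidal_nat_iso B C "nsrc \<beta>" "ntgt \<beta>" "ncomp \<beta>"
    using MCT_homD(3)[OF assms(2)] .
  interpret \<gamma>: monoidal_nat_iso C D "nsrc \<gamma>" "ntgt \<gamma>" "ncomp \<gamma>"
    using MCT_homD(3)[OF assms(3)] .
  show ?thesis
    by (rule MCT_hom_eqI[of _ A D])
      (use assms in \<open>auto intro!: MCT_hcomp_arr comp_monfunc_assoc MCT_homD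
        simp: \<gamma>.F.amap_cmp_arr\<close>)
qed

lemma MCT_hcomp_units:
  assumes "\<alpha> \<in> Arr (MCT_hom A B)"
  shows "amap (MCT_hcomp A B) (ident (MCT_hom B B) (id_monfunc B), \<alpha>) = \<alpha>"
    and "amap (MCT_hcomp A B) (\<alpha>, ident (MCT_hom A A) (id_monfunc A)) = \<alpha>"
proof -
  interpret \<alpha>: monoidal_nat_iso A B "nsrc \<alpha>" "ntgt \<alpha>" "ncomp \<alpha>"
    using MCT_homD(3)[OF assms] .
  interpret F: braided_monoidal_functor A B "nsrc \<alpha>"
    using MCT_homD(1)[OF assms] by (rule braided_functorsD)
  have ids: "id_monfunc A \<in> braided_functors A A" "id_monfunc B \<in> braided_functors B B"
    by (intro id_monfunc_braided F.A.braided_monoidal_category_axioms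
        F.B.braided_monoidal_category_axioms)+
  show "amap (MCT_hcomp A B) (ident (MCT_hom B B) (id_monfunc B), \<alpha>) = \<alpha>"
    by (rule MCT_hom_eqI[of _ A B]) (use assms ids in
      \<open>auto intro!: MCT_hcomp_arr MCT_ident_arr comp_monfunc_id_left MCT_homD\<close>)
  show "amap (MCT_hcomp A B) (\<alpha>, ident (MCT_hom A A) (id_monfunc A)) = \<alpha>"
    by (rule MCT_hom_eqI[of _ A B]) (use assms ids in
      \<open>auto intro!: MCT_hcomp_arr MCT_ident_arr comp_monfunc_id_right MCT_homD\<close>)
qed

section \<open>The 2-category\<close>

lemma MCT_simps [simp]:
  "Obj0 (MCT K) = {A. FRBSU K A}"
  "hcat (MCT K) = MCT_hom"
  "ident1 (MCT K) = id_monfunc"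
  "hcomp (MCT K) A B C = MCT_hcomp A C"
  "basc (MCT K) A B C D H G F = ident (MCT_hom A D) (comp_monfunc A D H (comp_monfunc A C G F))"
  "blun (MCT K) A B F = ident (MCT_hom A B) F"
  "brun (MCT K) A B F = ident (MCT_hom A B) F"
  by (simp_all add: MCT_def)

lemma MCT_ident_cmp:
  assumes "\<theta> \<in> Arr (MCT_hom A B)"
  shows "ntgt \<theta> = G \<Longrightarrow> ident (MCT_hom A B) G \<bullet>\<^bsub>MCT_hom A B\<^esub> \<theta> = \<theta>"
    and "nsrc \<theta> = F \<Longrightarrow> \<theta> \<bullet>\<^bsub>MCT_hom A B\<^esub> ident (MCT_hom A B) F = \<theta>"
  using category.cmp_ident_arr[OF category_MCT_hom assms] by auto

theorem proposition4p0p2: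
  fixes K :: "('k, 'n) ring_scheme"
  assumes "perfect_field K"
  shows "two_category (MCT K :: (('o, 'a, 'k) brmoncat, ('o, 'a, 'o, 'a) monfunc, ('o, 'a) ntrans) bicat)"
proof -
  have braided: "FRBSU K A \<Longrightarrow> braided_monoidal_category A" for A :: "('o, 'a, 'k) brmoncat"
    by (simp add: FRBSU_def)
  \<comment> \<open>The bracketing of a fourfold composite that the pentagon adds to those of triple composites.\<close>
  have assoc4: "comp_monfunc A E (comp_monfunc B E k (comp_monfunc B D h g)) f
      = comp_monfunc A E k (comp_monfunc A D h (comp_monfunc A C g f))"
    if "f \<in> braided_functors A B" "g \<in> braided_functors B C"
      "h \<in> braided_functors C D" "k \<in> braided_functors D E"
    for A B C D E :: "('o, 'a, 'k) brmoncat" and f g h k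
    using that comp_monfunc_assoc[of f A B "comp_monfunc B D h g" D k E]
    by (simp add: comp_monfunc_braided comp_monfunc_assoc)
  note iso = category.ident_isos[OF category_MCT_hom, simplified]
  show ?thesis
    \<comment> \<open>With all constraints identities, naturality of the associator and of the unit constraints is
      strict associativity and unitality of horizontal composition, and both sides of the pentagon and
      of the triangle reduce to a single identity, as horizontal composition preserves identities.\<close>
    by (intro two_category.intro bicategory.intro two_category_axioms.intro)
      (auto simp: braided category_MCT_hom cat_functor_MCT_hcomp id_monfunc_braided homset_def
        comp_monfunc_braided comp_monfunc_assoc comp_monfunc_id_left comp_monfunc_id_right
        MCT_hcomp_assoc MCT_hcomp_units MCT_hcomp_ident MCT_hcomp_arr MCT_ident_arr MCT_ident_cmp
        MCT_homD iso assoc4)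
qed

end
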